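(* Let $T\subset\mathbb{R}^3$ be the regular tetrahedron of edge length one, let $U$ be uniformly distributed on $S^2$, and let $W_T=w_T(U)$. Put $$t_0=\frac1{\sqrt2},\quad t_1=\sqrt{\frac23},\quad t_2=\frac{\sqrt3}{2},\quad t_3=1,\quad \alpha=\arctan\frac1{\sqrt2},\quad \gamma(t)=\arccos\left(\frac{t}{\sqrt{3(1-t^2)}}\right).$$ Then $W_T$ is absolutely continuous, with support $\left[\frac1{\sqrt2},1\right]$, and density $$f_T(t)=\begin{cases}0,& t<t_0,\\ 6-\dfrac{12}{\pi}\left(\alpha+\gamma(t)\right),& t_0\le t<t_1,\\ 6-\dfrac{24}{\pi}\gamma(t),& t_1\le t<t_2,\\ 6,& t_2\le t<t_3,\\ 0,& t\ge t_3.\end{cases}$$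
   Context: For a compact convex body $K\subset\mathbb{R}^3$, the width in direction $u\in S^2$ is $w_K(u)=\max_{x\in K}u\cdot x-\min_{x\in K}u\cdot x$. Concretely one may take $T=\operatorname{conv}\{v_1,v_2,v_3,v_4\}$ with $v_1=\frac{(1,1,1)}{\sqrt8}$, $v_2=\frac{(1,-1,-1)}{\sqrt8}$, $v_3=\frac{(-1,1,-1)}{\sqrt8}$, $v_4=\frac{(-1,-1,1)}{\sqrt8}$. "Uniformly distributed on $S^2$" refers to the rotation-invariant probability measure. *)

theory Defs
  imports "HOL-Probability.Probability"
begin

text \<open>
  For nonempty compact \<open>K\<close> the supremum and infimum below are attained, so this is the
  maximum minus the minimum of the linear functional \<open>x \<mapsto> u \<bullet> x\<close> on \<open>K\<close>.
\<close>
definition width :: "'a::euclidean_space set \<Rightarrow> 'a \<Rightarrow> real" where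
  "width K u = (SUP x\<in>K. u \<bullet> x) - (INF x\<in>K. u \<bullet> x)"

definition regular_tetrahedron :: "real \<Rightarrow> (real^3) set \<Rightarrow> bool" where
  "regular_tetrahedron a T \<longleftrightarrow>
     (\<exists>V. card V = 4 \<and> (\<forall>x\<in>V. \<forall>y\<in>V. x \<noteq> y \<longrightarrow> dist x y = a) \<and> T = convex hull V)"

text \<open>
  The rotation-invariant probability measure on the unit sphere, viewed as a Borel measure
  on the ambient space that is concentrated on the sphere.
\<close>
definition uniform_sphere_measure :: "(real^3) measure \<Rightarrow> bool" where
  "uniform_sphere_measure N \<longleftrightarrow>
     sets N = sets borel \<and> prob_space N \<and> emeasure N (sphere 0 1) = 1 \<and>
     (\<forall>Q :: real^3^3. rotation_matrix Q \<longrightarrow> distr N borel (\<lambda>x. Q *v x) = N)"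

definition measure_support :: "'a::topological_space measure \<Rightarrow> 'a set" where
  "measure_support N = {x. \<forall>S. open S \<and> x \<in> S \<longrightarrow> emeasure N S > 0}"

definition tet_alpha :: real where
  "tet_alpha = arctan (1 / sqrt 2)"

definition tet_gamma :: "real \<Rightarrow> real" where
  "tet_gamma t = arccos (t / sqrt (3 * (1 - t\<^sup>2)))"

definition tet_density :: "real \<Rightarrow> real" where
  "tet_density t =
     (if t < 1 / sqrt 2 then 0
      else if t < sqrt (2 / 3) then 6 - 12 / pi * (tet_alpha + tet_gamma t)
      else if t < sqrt 3 / 2 then 6 - 24 / pi * tet_gamma t
      else if t < 1 then 6
      else 0)"

end

(*
  A rotation-invariant law on the sphere is determined by two facts: the third coordinate is uniform
  on [-1, 1] (its moments satisfy a two-term recursion, obtained by expanding the invariant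
  quantity E (x3 + s x1)^(2k) / (1 + s^2)^k in s), and averaging over the rotations about the third
  axis makes the azimuth uniform and independent of it.

  The width of the tetrahedron is the length of its longest edge projection.  By symmetry each of the
  twelve directed edges is the longest one with equal probability, so with an edge direction as pole
  the width is the height z, uniform on [-1, 1], restricted to the azimuths at which no neighbouring
  edge direction has a larger inner product.  The density at t is therefore 12 * 1/2 times the
  proportion of such azimuths, which an elementary trigonometric inequality determines.
*)
theory Submission
  imports Defs
begin

section \<open>Moments and periodic integrals\<close>

text \<open>The symmetries of the tetrahedron used below are therefore even sign changes and cyclic
  permutations of coordinates. These generate its rotation group, of order twelve, which acts simply
  transitively on the directed edges.

  The constants come from one wave. With an edge as pole, it is the longest at height z and azimuth
  \<phi> iff |cos \<phi>| + sqrt 2 |sin \<phi>| \<le> z / sqrt (1 - z^2). In the first quadrant the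
  left side is sqrt 3 cos (\<phi> - \<beta>) with \<beta> = pi/2 - \<alpha>. Its values at 0, pi/2
  and \<beta> are 1, sqrt 2 and sqrt 3; equating the right side to them gives t0, t1 and t2. The
  angle \<gamma>(z) is the half-width of the excluded arc around \<beta>. Below t1 the arc reaches
  past pi/2 and leaves the length pi/2 - \<alpha> - \<gamma>; from t1 on it fits into the quadrant
  and leaves pi/2 - 2\<gamma>. Times 6 / (pi/2), these are the two branches.\<close>

lemma real_distribution_eqI_moments:
  fixes \<mu> \<nu> :: "real measure"
  assumes \<mu>: "real_distribution \<mu>" "AE x in \<mu>. \<bar>x\<bar> \<le> 1"
    and \<nu>: "real_distribution \<nu>" "AE x in \<nu>. \<bar>x\<bar> \<le> 1"
    and eq: "\<And>n. (\<integral>x. x ^ n \<partial>\<mu>) = (\<integral>x. x ^ n \<partial>\<nu>)"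
  shows "\<mu> = \<nu>"
proof (rule Levy_uniqueness[OF \<mu>(1) \<nu>(1)], rule ext)
  fix t :: real
  \<comment> \<open>\<open>p n\<close> is the Taylor polynomial of the characteristic function,
    written with the moments of \<open>\<mu>\<close>; by \<open>eq\<close> it serves
    \<open>\<nu>\<close> as well. Since |x| \<le> 1, absolute moments are at most 1 and the
    remainder tends to 0.\<close>
  define p where "p n = (\<Sum>k\<le>n. ((\<i> * t) ^ k / fact k) * (\<integral>x. x ^ k \<partial>\<mu>))" for n :: nat
  have approx: "cmod (char \<rho> t - p n) \<le> 2 * \<bar>t\<bar> ^ n / fact n"
    if "real_distribution \<rho>" and ae: "AE x in \<rho>. \<bar>x\<bar> \<le> 1"
      and m: "\<And>n. (\<integral>x. x ^ n \<partial>\<mu>) = (\<integral>x. x ^ n \<partial>\<rho>)" for \<rho> and n :: nat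
  proof -
    interpret real_distribution \<rho> by fact
    have int: "integrable \<rho> (\<lambda>x. x ^ k)" for k
      by (rule integrable_const_bound[where B = 1])
        (use ae in \<open>auto simp: power_abs power_le_one elim!: eventually_mono\<close>)
    have "expectation (\<lambda>x. \<bar>x\<bar> ^ n) \<le> expectation (\<lambda>x. 1)"
      by (rule integral_mono_AE)
        (use ae integrable_norm[OF int, of n] in \<open>auto simp: power_abs power_le_one elim!: eventually_mono\<close>)
    then have "2 * \<bar>t\<bar> ^ n / fact n * expectation (\<lambda>x. \<bar>x\<bar> ^ n) \<le> 2 * \<bar>t\<bar> ^ n / fact n * 1"
      by (intro mult_left_mono) (use prob_space in auto)
    moreover have "cmod (char \<rho> t - p n) \<le> 2 * \<bar>t\<bar> ^ n / fact n * expectation (\<lambda>x. \<bar>x\<bar> ^ n)"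
      unfolding p_def m by (rule char_approx1) (rule int)
    ultimately show ?thesis by simp
  qed
  have "(\<lambda>n. 2 * (inverse (fact n) * \<bar>t\<bar> ^ n)) \<longlonglongrightarrow> 2 * 0"
    by (intro tendsto_mult tendsto_const summable_LIMSEQ_zero summable_exp)
  then have lim: "(\<lambda>n. 2 * \<bar>t\<bar> ^ n / fact n) \<longlonglongrightarrow> 0" by (simp add: field_simps)
  have \<mu>_lim: "(\<lambda>n. char \<mu> t - p n) \<longlonglongrightarrow> 0" and \<nu>_lim: "(\<lambda>n. char \<nu> t - p n) \<longlonglongrightarrow> 0"
    by (rule Lim_null_comparison[OF always_eventually lim]; use approx[OF \<mu>] approx[OF \<nu> eq] in simp)+
  have "(\<lambda>n. char \<mu> t - char \<nu> t) \<longlonglongrightarrow> 0"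
    using tendsto_diff[OF \<mu>_lim \<nu>_lim] by simp
  then show "char \<mu> t = char \<nu> t" by (simp add: LIMSEQ_const_iff)
qed

definition uniform_interval :: "real measure" where
  "uniform_interval = density lborel (\<lambda>z. ennreal (indicator {-1..1} z / 2))"

lemma nn_integral_uniform_interval:
  assumes [measurable]: "f \<in> borel_measurable borel"
  shows "(\<integral>\<^sup>+z. f z \<partial>uniform_interval) = (\<integral>\<^sup>+z. ennreal (indicator {-1..1} z / 2) * f z \<partial>lborel)"
  unfolding uniform_interval_def by (subst nn_integral_density) auto

lemma uniform_interval_moment:
  "(\<integral>z. z ^ n \<partial>uniform_interval) = (if even n then 1 / (n + 1) else 0)"
proof -
  have "(\<integral>z. z ^ n \<partial>uniform_interval) = (\<integral>z. (1/2) * (z ^ n * indicator {-1..1} z) \<partial>lborel)"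
    unfolding uniform_interval_def
    by (subst integral_density) (auto intro!: Bochner_Integration.integral_cong)
  also have "\<dots> = (1/2) * ((1 ^ Suc n - (-1) ^ Suc n) / Suc n)"
    by (subst integral_mult_right_zero, subst integral_power) auto
  also have "\<dots> = (if even n then 1 / (n + 1) else 0)"
  proof (cases "even n")
    case True
    then show ?thesis by (simp add: field_simps)
  qed simp
  finally show ?thesis by simp
qed

lemma real_distribution_uniform_interval: "real_distribution uniform_interval"
proof -
  have "emeasure uniform_interval UNIV = (\<integral>\<^sup>+z. ennreal (1/2) * indicator {-1..1::real} z \<partial>lborel)"
    unfolding uniform_interval_def
    by (subst emeasure_density) (auto intro!: nn_integral_cong split: split_indicator)
  also have "\<dots> = ennreal (1/2) * ennreal 2"
    by (subst nn_integral_cmult) simp_all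
  also have "\<dots> = ennreal (1/2 * 2)"
    by (rule ennreal_mult[symmetric]) auto
  finally show ?thesis
    by (auto simp: uniform_interval_def intro!: real_distribution.intro prob_spaceI real_distribution_axioms.intro)
qed

lemma AE_uniform_interval: "AE z in uniform_interval. \<bar>z\<bar> \<le> 1"
  unfolding uniform_interval_def by (subst AE_density) (auto simp: indicator_def)

text \<open>The shifted window is cut at \<open>p\<close> and the part beyond \<open>p\<close> moved
  back by one period. Half-open intervals make both cuts exact at every point.\<close>

lemma nn_integral_periodic:
  fixes f :: "real \<Rightarrow> ennreal"
  assumes [measurable]: "f \<in> borel_measurable borel"
    and per: "\<And>x. f (x + p) = f x" and \<theta>: "0 \<le> \<theta>" "\<theta> \<le> p"
  shows "(\<integral>\<^sup>+x. f (\<theta> + x) * indicator {0..<p} x \<partial>lborel) = (\<integral>\<^sup>+x. f x * indicator {0..<p} x \<partial>lborel)"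
proof -
  have "(\<integral>\<^sup>+x. f (\<theta> + x) * indicator {0..<p} x \<partial>lborel) = (\<integral>\<^sup>+x. f x * indicator {\<theta>..<\<theta>+p} x \<partial>lborel)"
    by (subst (2) nn_integral_real_affine[where t = \<theta> and c = 1]) (auto intro!: nn_integral_cong simp: indicator_def)
  also have "\<dots> = (\<integral>\<^sup>+x. f x * indicator {\<theta>..<p} x + f x * indicator {p..<\<theta>+p} x \<partial>lborel)"
    using \<theta> by (intro nn_integral_cong) (auto simp: indicator_def)
  also have "\<dots> = (\<integral>\<^sup>+x. f x * indicator {\<theta>..<p} x \<partial>lborel) + (\<integral>\<^sup>+x. f x * indicator {p..<\<theta>+p} x \<partial>lborel)"
    by (rule nn_integral_add) auto
  also have "(\<integral>\<^sup>+x. f x * indicator {p..<\<theta>+p} x \<partial>lborel) = (\<integral>\<^sup>+x. f x * indicator {0..<\<theta>} x \<partial>lborel)"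
    by (subst nn_integral_real_affine[where t = p and c = 1])
      (auto intro!: nn_integral_cong simp: indicator_def per add.commute[of p])
  also have "(\<integral>\<^sup>+x. f x * indicator {\<theta>..<p} x \<partial>lborel) + \<dots> =
      (\<integral>\<^sup>+x. f x * indicator {\<theta>..<p} x + f x * indicator {0..<\<theta>} x \<partial>lborel)"
    by (rule nn_integral_add[symmetric]) auto
  also have "\<dots> = (\<integral>\<^sup>+x. f x * indicator {0..<p} x \<partial>lborel)"
    using \<theta> by (intro nn_integral_cong) (auto simp: indicator_def)
  finally show ?thesis .
qed

section \<open>The uniform distribution on the sphere\<close>

lemma borel_measurable_vec_nth [measurable]:
  fixes f :: "'b \<Rightarrow> real ^ 'n"
  assumes [measurable]: "f \<in> borel_measurable M"
  shows "(\<lambda>x. f x $ i) \<in> borel_measurable M"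
proof -
  have "(\<lambda>x. f x $ i) = (\<lambda>x. f x \<bullet> axis i 1)" by (simp add: inner_axis)
  then show ?thesis by simp
qed

lemma borel_measurable_vector_3 [measurable]:
  fixes f g h :: "'b \<Rightarrow> real"
  assumes [measurable]: "f \<in> borel_measurable M" "g \<in> borel_measurable M" "h \<in> borel_measurable M"
  shows "(\<lambda>x. vector [f x, g x, h x] :: real ^ 3) \<in> borel_measurable M"
proof -
  have "(\<lambda>x. vector [f x, g x, h x] :: real ^ 3) =
      (\<lambda>x. f x *\<^sub>R axis 1 1 + g x *\<^sub>R axis 2 1 + h x *\<^sub>R axis 3 1)"
    by (auto simp: vec_eq_iff forall_3 axis_def)
  then show ?thesis by simp
qed

section \<open>Rotations as explicit matrices\<close>

abbreviation mat3 :: "real \<Rightarrow> real \<Rightarrow> real \<Rightarrow> real \<Rightarrow> real \<Rightarrow> real \<Rightarrow> real \<Rightarrow> real \<Rightarrow> real \<Rightarrow> real^3^3" where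
  "mat3 a b c d e f g h i \<equiv> vector [vector [a, b, c], vector [d, e, f], vector [g, h, i]]"

lemma mat3_vector_mult:
  "mat3 a b c d e f g h i *v x = vector
    [a * x$1 + b * x$2 + c * x$3, d * x$1 + e * x$2 + f * x$3, g * x$1 + h * x$2 + i * x$3]"
  by (simp add: vec_eq_iff forall_3 matrix_vector_mult_def sum_3)

lemma rotation_mat3I:
  assumes "a\<^sup>2 + b\<^sup>2 + c\<^sup>2 = 1" "d\<^sup>2 + e\<^sup>2 + f\<^sup>2 = 1" "g\<^sup>2 + h\<^sup>2 + i\<^sup>2 = 1"
    "a * d + b * e + c * f = 0" "a * g + b * h + c * i = 0" "d * g + e * h + f * i = 0"
    "a * e * i + b * f * g + c * d * h - a * f * h - b * d * i - c * e * g = 1"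
  shows "rotation_matrix (mat3 a b c d e f g h i)"
proof -
  have "mat3 a b c d e f g h i ** transpose (mat3 a b c d e f g h i) = mat 1"
    using assms by (simp add: vec_eq_iff forall_3 matrix_matrix_mult_def sum_3 transpose_def mat_def
        power2_eq_square algebra_simps)
  then have "transpose (mat3 a b c d e f g h i) ** mat3 a b c d e f g h i = mat 1"
    by (rule matrix_left_right_inverse[THEN iffD1])
  then show ?thesis
    using assms(7) by (simp add: rotation_matrix_def orthogonal_matrix det_3)
qed

lemma measurable_mult_vec [measurable]: "(\<lambda>x. Q *v x) \<in> borel_measurable (borel :: (real^3) measure)"
  for Q :: "real^3^3"
  by (intro borel_measurable_continuous_onI linear_continuous_on matrix_vector_mul_bounded_linear)

text \<open>Serves the comparison of coefficients in \<open>mixed_moment\<close>. The induction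
  carries the coefficients 0 and 1 along, because the coefficient 2 of a product involves all
  three.\<close>

lemma coeff_2_power: "coeff ([:1, 0, 1 :: real:] ^ k) 2 = real k"
proof -
  have "coeff ([:1, 0, 1 :: real:] ^ k) 0 = 1 \<and> coeff ([:1, 0, 1 :: real:] ^ k) 1 = 0 \<and> coeff ([:1, 0, 1 :: real:] ^ k) 2 = real k"
    by (induction k) (auto simp: coeff_mult numeral_2_eq_2)
  then show ?thesis by simp
qed

definition cylinder :: "real \<Rightarrow> real \<Rightarrow> real^3" where
  "cylinder z \<phi> = vector [sqrt (1 - z\<^sup>2) * cos \<phi>, sqrt (1 - z\<^sup>2) * sin \<phi>, z]"

lemma borel_measurable_cylinder [measurable (raw)]:
  assumes [measurable]: "f \<in> borel_measurable M" "g \<in> borel_measurable M"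
  shows "(\<lambda>x. cylinder (f x) (g x)) \<in> borel_measurable M"
  unfolding cylinder_def by measurable

locale uniform_sphere =
  fixes N :: "(real^3) measure"
  assumes uniform: "uniform_sphere_measure N"
begin

sublocale prob_space N
  using uniform by (simp add: uniform_sphere_measure_def)

lemma sets_N [simp, measurable_cong]: "sets N = sets borel"
  using uniform by (simp add: uniform_sphere_measure_def)

lemma space_N [simp]: "space N = UNIV"
  using sets_eq_imp_space_eq[OF sets_N] by simp

lemma AE_sphere: "AE x in N. (x$1)\<^sup>2 + (x$2)\<^sup>2 + (x$3)\<^sup>2 = 1"
proof -
  have "emeasure N (sphere 0 1) = 1"
    using uniform by (simp add: uniform_sphere_measure_def)
  then have "AE x in N. x \<in> sphere 0 1"
    by (intro AE_in_set_eq_1[THEN iffD2]) (auto simp: measure_def)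
  then show ?thesis
    by eventually_elim (simp add: norm_eq_1 inner_vec_def sum_3 power2_eq_square)
qed

lemma distr_rotation: "rotation_matrix Q \<Longrightarrow> distr N borel (\<lambda>x. Q *v x) = N"
  using uniform by (simp add: uniform_sphere_measure_def)

lemma nn_integral_rotation:
  assumes [measurable]: "f \<in> borel_measurable borel" and "rotation_matrix Q"
  shows "(\<integral>\<^sup>+x. f (Q *v x) \<partial>N) = (\<integral>\<^sup>+x. f x \<partial>N)"
  by (subst (2) distr_rotation[OF assms(2), symmetric], subst nn_integral_distr) auto

lemma integral_rotation:
  fixes f :: "_ \<Rightarrow> real"
  assumes [measurable]: "f \<in> borel_measurable borel" and "rotation_matrix Q"
  shows "(\<integral>x. f (Q *v x) \<partial>N) = (\<integral>x. f x \<partial>N)"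
  by (subst (2) distr_rotation[OF assms(2), symmetric], subst integral_distr) auto

lemma AE_abs_le_1: "AE x in N. \<bar>x$1\<bar> \<le> 1 \<and> \<bar>x$2\<bar> \<le> 1 \<and> \<bar>x$3\<bar> \<le> 1"
  using AE_sphere
proof eventually_elim
  case (elim x)
  then have "(x$1)\<^sup>2 \<le> 1\<^sup>2" "(x$2)\<^sup>2 \<le> 1\<^sup>2" "(x$3)\<^sup>2 \<le> 1\<^sup>2"
    by (smt (verit) one_power2 zero_le_power2)+
  then show ?case by (simp only: abs_le_square_iff[symmetric] abs_one)
qed

lemma integrable_monomial: "integrable N (\<lambda>x. (x$1) ^ i * (x$2) ^ j * (x$3) ^ k)"
proof (rule integrable_const_bound[where B = 1])
  show "AE x in N. norm ((x$1) ^ i * (x$2) ^ j * (x$3) ^ k) \<le> 1"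
    using AE_abs_le_1 by eventually_elim (simp add: abs_mult power_abs mult_le_one power_le_one)
qed simp

section \<open>Moments of the third coordinate\<close>

definition moment :: "nat \<Rightarrow> real" where
  "moment n = (\<integral>x. (x$3) ^ n \<partial>N)"

text \<open>A half-turn about the first axis reverses the third; the reflection in the equator has
  determinant -1 and is not covered by the invariance.\<close>

lemma moment_odd:
  assumes "odd n"
  shows "moment n = 0"
proof -
  have "moment n = (\<integral>x. ((mat3 1 0 0 0 (-1) 0 0 0 (-1) *v x)$3) ^ n \<partial>N)"
    unfolding moment_def by (rule integral_rotation[symmetric]) (auto intro!: rotation_mat3I)
  also have "\<dots> = - moment n"
    using assms by (simp add: mat3_vector_mult moment_def)
  finally show ?thesis by simp
qed

text \<open>The functional has norm \<open>r = sqrt (1 + s\<^sup>2)\<close>, and divided by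
  \<open>r\<close> it is the third coordinate after a rotation about the second axis. The even
  exponent makes the power of \<open>r\<close> a polynomial in \<open>s\<close>.\<close>

lemma integral_power_shear:
  "(\<integral>x. (x$3 + s * x$1) ^ (2 * k) \<partial>N) = (1 + s\<^sup>2) ^ k * moment (2 * k)"
proof -
  define r where "r = sqrt (1 + s\<^sup>2)"
  have r2: "r\<^sup>2 = 1 + s\<^sup>2" by (simp add: r_def add_nonneg_nonneg)
  have r: "r > 0" unfolding r_def by (simp add: add_pos_nonneg)
  have "1 / r * (1 / r) + s / r * (s / r) = (1 + s\<^sup>2) / r\<^sup>2"
    using r by (simp add: power2_eq_square add_divide_distrib)
  also have "\<dots> = 1" unfolding r2[symmetric] using r by simp
  finally have one: "(1 / r)\<^sup>2 + (s / r)\<^sup>2 = 1" by (simp only: power2_eq_square)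
  have "(\<integral>x. ((mat3 (1/r) 0 (-s/r) 0 1 0 (s/r) 0 (1/r) *v x)$3) ^ (2*k) \<partial>N) = moment (2*k)"
    unfolding moment_def
    by (rule integral_rotation) (use one in \<open>auto intro!: rotation_mat3I simp: power2_eq_square algebra_simps\<close>)
  moreover have "(x$3 + s * x$1) ^ (2 * k) =
      (1 + s\<^sup>2) ^ k * ((mat3 (1/r) 0 (-s/r) 0 1 0 (s/r) 0 (1/r) *v x)$3) ^ (2*k)" for x :: "real^3"
  proof -
    have "x$3 + s * x$1 = r * (mat3 (1/r) 0 (-s/r) 0 1 0 (s/r) 0 (1/r) *v x)$3"
      using r by (simp add: mat3_vector_mult field_simps)
    then show ?thesis by (simp add: power_mult_distrib power_mult r2)
  qed
  ultimately show ?thesis by simp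
qed

text \<open>Comparison of the coefficients of \<open>s\<^sup>2\<close> in the preceding identity.\<close>
lemma mixed_moment:
  "real (2 * k + 1) * (\<integral>x. (x$1)\<^sup>2 * (x$3) ^ (2 * k) \<partial>N) = moment (2 * k + 2)"
proof -
  define n where "n = 2 * Suc k"
  define c where "c j = real (n choose j) * (\<integral>x. (x$1) ^ j * (x$3) ^ (n - j) \<partial>N)" for j
  define p where "p = (\<Sum>j\<le>n. Polynomial.monom (c j) j)"
  have int: "integrable N (\<lambda>x. (x$1) ^ j * (x$3) ^ i)" for i j
    using integrable_monomial[of j 0 i] by simp
  have "poly p s = poly (Polynomial.smult (moment n) ([:1, 0, 1:] ^ Suc k)) s" for s
  proof -
    have "poly p s = (\<Sum>j\<le>n. \<integral>x. real (n choose j) * s ^ j * ((x$1) ^ j * (x$3) ^ (n - j)) \<partial>N)"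
      by (simp add: p_def poly_sum poly_monom c_def mult_ac)
    also have "\<dots> = (\<integral>x. (\<Sum>j\<le>n. real (n choose j) * s ^ j * ((x$1) ^ j * (x$3) ^ (n - j))) \<partial>N)"
      by (rule Bochner_Integration.integral_sum[symmetric]) (intro integrable_mult_right int)
    also have "\<dots> = (\<integral>x. (s * x$1 + x$3) ^ n \<partial>N)"
      by (simp add: binomial_ring power_mult_distrib mult_ac)
    also have "\<dots> = (1 + s\<^sup>2) ^ Suc k * moment n"
      unfolding n_def integral_power_shear[symmetric] by (simp only: add.commute)
    finally show ?thesis by (simp add: power2_eq_square algebra_simps)
  qed
  then have "p = Polynomial.smult (moment n) ([:1, 0, 1:] ^ Suc k)"
    by (intro poly_eq_poly_eq_iff[THEN iffD1] ext)
  then have "coeff p 2 = moment n * real (Suc k)"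
    by (simp only: coeff_smult coeff_2_power)
  moreover have "coeff p 2 = c 2"
    by (simp add: p_def coeff_sum n_def numeral_2_eq_2)
  moreover have "real (n choose 2) = real (2 * k + 1) * real (Suc k)"
  proof -
    have "n choose 2 = (2 * k + 1) * Suc k" by (simp add: n_def choose_two algebra_simps)
    then show ?thesis by (simp only: of_nat_mult)
  qed
  \<comment> \<open>The factor \<open>Suc k\<close> occurs on both sides, from
    \<open>n choose 2\<close> on the left and from the power of \<open>1 + s\<^sup>2\<close> on the
    right, and cancels.\<close>
  ultimately have "real (Suc k) * (real (2 * k + 1) * (\<integral>x. (x$1)\<^sup>2 * (x$3) ^ (2 * k) \<partial>N))
      = real (Suc k) * moment (2 * k + 2)"
    by (simp add: c_def mult_ac n_def)
  then show ?thesis by (subst (asm) mult_cancel_left) simp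
qed

text \<open>The equation of the sphere, inserted as a factor 1, splits \<open>moment (2 * k)\<close>
  into two mixed moments, equal by a quarter-turn, and \<open>moment (2 * k + 2)\<close>. With
  \<open>mixed_moment\<close> it follows that \<open>(2 * k + 1) * moment (2 * k)\<close> does not
  depend on \<open>k\<close>.\<close>

lemma moment_even: "moment (2 * k) = 1 / (2 * k + 1)"
proof (induction k)
  case 0
  show ?case using prob_space by (simp add: moment_def)
next
  case (Suc k)
  define B where "B = (\<integral>x. (x$1)\<^sup>2 * (x$3) ^ (2 * k) \<partial>N)"
  have B2: "(\<integral>x. (x$2)\<^sup>2 * (x$3) ^ (2 * k) \<partial>N) = B"
  proof -
    have "B = (\<integral>x. ((mat3 0 (-1) 0 1 0 0 0 0 1 *v x)$1)\<^sup>2 * ((mat3 0 (-1) 0 1 0 0 0 0 1 *v x)$3) ^ (2 * k) \<partial>N)"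
      unfolding B_def by (rule integral_rotation[symmetric]) (auto intro!: rotation_mat3I)
    then show ?thesis by (simp add: mat3_vector_mult)
  qed
  have "moment (2 * k) = (\<integral>x. (x$1)\<^sup>2 * (x$3) ^ (2 * k) + (x$2)\<^sup>2 * (x$3) ^ (2 * k) + (x$3) ^ (2 * k + 2) \<partial>N)"
    unfolding moment_def
  proof (rule integral_cong_AE)
    show "AE x in N. (x$3) ^ (2 * k) =
        (x$1)\<^sup>2 * (x$3) ^ (2 * k) + (x$2)\<^sup>2 * (x$3) ^ (2 * k) + (x$3) ^ (2 * k + 2)"
      using AE_sphere
    proof eventually_elim
      case (elim x)
      have "(x$3) ^ (2 * k) = ((x$1)\<^sup>2 + (x$2)\<^sup>2 + (x$3)\<^sup>2) * (x$3) ^ (2 * k)"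
        by (simp add: elim)
      then show ?case by (simp add: algebra_simps power_add power2_eq_square)
    qed
  qed auto
  also have "\<dots> = B + B + moment (2 * k + 2)"
    using integrable_monomial[of 2 0 "2*k"] integrable_monomial[of 0 2 "2*k"] integrable_monomial[of 0 0 "2*k+2"]
    by (simp add: B_def[symmetric] B2 moment_def)
  finally have "moment (2 * k) = B + B + moment (2 * k + 2)" .
  moreover have "real (2 * k + 1) * B = moment (2 * k + 2)"
    unfolding B_def by (rule mixed_moment)
  ultimately have "(2 * k + 1) * moment (2 * k) = (2 * k + 3) * moment (2 * k + 2)"
    by (simp add: algebra_simps)
  then show ?case using Suc.IH by (simp add: field_simps)
qed

text \<open>Archimedes' hat-box theorem. Both laws live on [-1, 1], so their moments decide.\<close>

lemma distr_third_coordinate: "distr N borel (\<lambda>x. x$3) = uniform_interval"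
proof (rule real_distribution_eqI_moments)
  show "real_distribution (distr N borel (\<lambda>x. x$3))"
    by (rule real_distribution_distr) simp
  show "AE z in distr N borel (\<lambda>x. x$3). \<bar>z\<bar> \<le> 1"
    using AE_abs_le_1 by (subst AE_distr_iff) auto
  show "(\<integral>z. z ^ n \<partial>distr N borel (\<lambda>x. x$3)) = (\<integral>z. z ^ n \<partial>uniform_interval)" for n
  proof -
    have "(\<integral>z. z ^ n \<partial>distr N borel (\<lambda>x. x$3)) = moment n"
      by (subst integral_distr) (auto simp: moment_def)
    then show ?thesis
      by (cases "even n") (auto simp: uniform_interval_moment moment_odd moment_even elim!: evenE)
  qed
qed (auto simp: real_distribution_uniform_interval AE_uniform_interval)

text \<open>Averaging over the rotations about the third axis makes the integrand a function of the
  third coordinate alone, which is uniformly distributed.\<close>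
lemma nn_integral_cylinder:
  assumes [measurable]: "f \<in> borel_measurable borel"
  shows "ennreal (2 * pi) * (\<integral>\<^sup>+x. f x \<partial>N) =
    (\<integral>\<^sup>+z. (\<integral>\<^sup>+\<phi>. f (cylinder z \<phi>) * indicator {0..<2*pi} \<phi> \<partial>lborel) \<partial>uniform_interval)"
proof -
  define R where "R \<phi> x = (vector [cos \<phi> * x$1 - sin \<phi> * x$2, sin \<phi> * x$1 + cos \<phi> * x$2, x$3] :: real^3)"
    for \<phi> and x :: "real^3"
  have R[measurable]: "(\<lambda>p. R (fst p) (snd p)) \<in> borel_measurable (lborel \<Otimes>\<^sub>M N)"
    unfolding R_def by measurable
  have [measurable]: "R \<phi> \<in> borel_measurable N" for \<phi>
    unfolding R_def by measurable
  interpret P: pair_sigma_finite lborel N ..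
  have inv: "(\<integral>\<^sup>+x. f (R \<phi> x) \<partial>N) = (\<integral>\<^sup>+x. f x \<partial>N)" for \<phi>
  proof -
    have "R \<phi> = (\<lambda>x. mat3 (cos \<phi>) (- sin \<phi>) 0 (sin \<phi>) (cos \<phi>) 0 0 0 1 *v x)"
      by (auto simp: R_def mat3_vector_mult)
    moreover have "rotation_matrix (mat3 (cos \<phi>) (- sin \<phi>) 0 (sin \<phi>) (cos \<phi>) 0 0 0 1)"
      by (rule rotation_mat3I) (simp_all add: algebra_simps flip: power2_eq_square)
    ultimately show ?thesis by (simp add: nn_integral_rotation)
  qed
  have "ennreal (2 * pi) * (\<integral>\<^sup>+x. f x \<partial>N) =
      (\<integral>\<^sup>+\<phi>. (\<integral>\<^sup>+x. f x \<partial>N) * indicator {0..<2*pi} \<phi> \<partial>lborel)"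
    by (subst nn_integral_cmult_indicator) (auto simp: mult.commute)
  also have "\<dots> = (\<integral>\<^sup>+\<phi>. (\<integral>\<^sup>+x. f (R \<phi> x) * indicator {0..<2*pi} \<phi> \<partial>N) \<partial>lborel)"
    by (subst nn_integral_multc) (auto simp: inv)
  also have "\<dots> = (\<integral>\<^sup>+x. (\<integral>\<^sup>+\<phi>. f (R \<phi> x) * indicator {0..<2*pi} \<phi> \<partial>lborel) \<partial>N)"
    by (rule P.Fubini'[symmetric]) measurable
  also have "\<dots> = (\<integral>\<^sup>+x. (\<integral>\<^sup>+\<phi>. f (cylinder (x$3) \<phi>) * indicator {0..<2*pi} \<phi> \<partial>lborel) \<partial>N)"
  proof (rule nn_integral_cong_AE)
    show "AE x in N. (\<integral>\<^sup>+\<phi>. f (R \<phi> x) * indicator {0..<2*pi} \<phi> \<partial>lborel) =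
        (\<integral>\<^sup>+\<phi>. f (cylinder (x$3) \<phi>) * indicator {0..<2*pi} \<phi> \<partial>lborel)"
      using AE_sphere
    proof eventually_elim
      case (elim x)
      define s where "s = sqrt (1 - (x$3)\<^sup>2)"
      have s2: "s\<^sup>2 = (x$1)\<^sup>2 + (x$2)\<^sup>2"
        unfolding s_def using elim by (subst real_sqrt_pow2) (smt (verit) zero_le_power2)+
      \<comment> \<open>\<open>\<theta>\<close> is the azimuth of \<open>x\<close>; at the poles it
        is arbitrary and 0 serves. Rotation by \<open>\<phi>\<close> adds \<open>\<phi>\<close> to
        it, and periodicity absorbs the offset.\<close>
      obtain \<theta> where \<theta>: "0 \<le> \<theta>" "\<theta> \<le> 2 * pi" "x$1 = s * cos \<theta>" "x$2 = s * sin \<theta>"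
      proof (cases "s = 0")
        case True
        then show ?thesis using s2 that[of 0] by (auto simp: sum_power2_eq_zero_iff)
      next
        case False
        have "(x$1 / s)\<^sup>2 + (x$2 / s)\<^sup>2 = s\<^sup>2 / s\<^sup>2"
          by (simp only: s2 power_divide add_divide_distrib)
        with False have "(x$1 / s)\<^sup>2 + (x$2 / s)\<^sup>2 = 1" by simp
        then obtain t where "0 \<le> t" "t \<le> 2 * pi" "x$1 / s = cos t" "x$2 / s = sin t"
          using sincos_total_2pi_le by blast
        then show ?thesis using that[of t] False by (auto simp: field_simps)
      qed
      have "R \<phi> x = cylinder (x$3) (\<theta> + \<phi>)" for \<phi>
        unfolding R_def cylinder_def s_def[symmetric] \<theta>(3,4) by (simp add: cos_add sin_add algebra_simps)
      then have "(\<integral>\<^sup>+\<phi>. f (R \<phi> x) * indicator {0..<2*pi} \<phi> \<partial>lborel) =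
          (\<integral>\<^sup>+\<phi>. f (cylinder (x$3) (\<theta> + \<phi>)) * indicator {0..<2*pi} \<phi> \<partial>lborel)"
        by simp
      also have "\<dots> = (\<integral>\<^sup>+\<phi>. f (cylinder (x$3) \<phi>) * indicator {0..<2*pi} \<phi> \<partial>lborel)"
        by (rule nn_integral_periodic[OF _ _ \<theta>(1,2)]) (auto simp: cylinder_def)
      finally show ?case .
    qed
  qed
  also have "\<dots> = (\<integral>\<^sup>+z. (\<integral>\<^sup>+\<phi>. f (cylinder z \<phi>) * indicator {0..<2*pi} \<phi> \<partial>lborel) \<partial>distr N borel (\<lambda>x. x$3))"
    by (subst nn_integral_distr) auto
  finally show ?thesis by (simp add: distr_third_coordinate)
qed

end

section \<open>The density\<close>

text \<open>The maps pi - x, pi + x and 2 pi - x carry the first quarter circle to the other three.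
  The closed quarters overlap only in end points, which are null.\<close>

lemma nn_integral_quadrant:
  fixes h :: "real \<Rightarrow> ennreal"
  assumes [measurable]: "h \<in> borel_measurable borel"
    and shift: "\<And>x. h (pi + x) = h x" and refl: "\<And>x. h (- x) = h x"
  shows "(\<integral>\<^sup>+x. h x * indicator {0..<2*pi} x \<partial>lborel) = 4 * (\<integral>\<^sup>+x. h x * indicator {0..pi/2} x \<partial>lborel)"
proof -
  define I where "I = (\<integral>\<^sup>+x. h x * indicator {0..pi/2} x \<partial>lborel)"
  have [simp]: "h (pi - x) = h x" "h (2 * pi - x) = h x" for x
    using shift[of "-x"] shift[of "pi - x"] refl[of x] by (simp_all add: algebra_simps)
  have 1: "(\<integral>\<^sup>+x. h x * indicator {pi/2..pi} x \<partial>lborel) = I"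
    by (subst nn_integral_real_affine[where t = pi and c = "-1"])
      (auto simp: I_def indicator_def intro!: nn_integral_cong)
  have 2: "(\<integral>\<^sup>+x. h x * indicator {pi..3*pi/2} x \<partial>lborel) = I"
    by (subst nn_integral_real_affine[where t = pi and c = "1"])
      (auto simp: I_def indicator_def shift intro!: nn_integral_cong)
  have 3: "(\<integral>\<^sup>+x. h x * indicator {3*pi/2..2*pi} x \<partial>lborel) = I"
    by (subst nn_integral_real_affine[where t = "2 * pi" and c = "-1"])
      (auto simp: I_def indicator_def intro!: nn_integral_cong)
  have "(\<integral>\<^sup>+x. h x * indicator {0..<2*pi} x \<partial>lborel) = (\<integral>\<^sup>+x. h x * indicator {0..pi/2} x +
      h x * indicator {pi/2..pi} x + h x * indicator {pi..3*pi/2} x + h x * indicator {3*pi/2..2*pi} x \<partial>lborel)"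
  proof (rule nn_integral_cong_AE)
    have "AE x in lborel. x \<noteq> pi/2 \<and> x \<noteq> pi \<and> x \<noteq> 3*pi/2 \<and> x \<noteq> 2*pi"
      using AE_lborel_singleton[of "pi/2"] AE_lborel_singleton[of pi]
        AE_lborel_singleton[of "3*pi/2"] AE_lborel_singleton[of "2*pi"] by eventually_elim auto
    then show "AE x in lborel. h x * indicator {0..<2*pi} x = h x * indicator {0..pi/2} x +
      h x * indicator {pi/2..pi} x + h x * indicator {pi..3*pi/2} x + h x * indicator {3*pi/2..2*pi} x"
      by eventually_elim (auto simp: indicator_def)
  qed
  also have "\<dots> = I + I + I + I"
    by (simp add: nn_integral_add 1 2 3) (simp add: I_def)
  also have "\<dots> = 4 * I"
  proof -
    have "(4 :: ennreal) = 1 + 1 + 1 + 1" by simp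
    then show ?thesis by (simp only: distrib_right mult_1)
  qed
  finally show ?thesis by (simp add: I_def)
qed

section \<open>The angles \<alpha> and \<gamma> and the thresholds\<close>

lemma cos_tet_alpha: "cos tet_alpha = sqrt 2 / sqrt 3" and sin_tet_alpha: "sin tet_alpha = 1 / sqrt 3"
  by (simp_all add: tet_alpha_def cos_arctan sin_arctan power_divide real_sqrt_divide)

lemma tet_alpha_bounds: "0 < tet_alpha" "tet_alpha < pi / 4"
proof -
  show "0 < tet_alpha" by (simp add: tet_alpha_def)
  have "arctan (1 / sqrt 2) < arctan 1" by (subst arctan_less_iff) simp
  then show "tet_alpha < pi / 4" by (simp add: tet_alpha_def arctan_one)
qed

lemma tet_gamma_arg_le_iff:
  fixes t c :: real
  assumes "0 \<le> t" "t < 1" "0 \<le> c"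
  shows "t / sqrt (3 * (1 - t\<^sup>2)) \<le> c \<longleftrightarrow> t\<^sup>2 \<le> c\<^sup>2 * (3 * (1 - t\<^sup>2))"
proof -
  have p: "3 * (1 - t\<^sup>2) > 0" using assms by (simp add: power_less_one_iff abs_square_less_1)
  have "t / sqrt (3 * (1 - t\<^sup>2)) \<le> c \<longleftrightarrow> t \<le> c * sqrt (3 * (1 - t\<^sup>2))"
    using p by (simp add: pos_divide_le_eq)
  also have "\<dots> \<longleftrightarrow> t\<^sup>2 \<le> (c * sqrt (3 * (1 - t\<^sup>2)))\<^sup>2"
    using assms p by (intro power_mono_iff[symmetric]) auto
  also have "\<dots> \<longleftrightarrow> t\<^sup>2 \<le> c\<^sup>2 * (3 * (1 - t\<^sup>2))"
    using p by (simp add: power_mult_distrib)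
  finally show ?thesis .
qed

text \<open>The argument of \<open>arccos\<close> equals \<open>1 / sqrt 3\<close>,
  \<open>sqrt 2 / sqrt 3\<close> and 1 exactly where t^2 is 1/2, 2/3 and 3/4. The first two are the
  cosines of pi/2 - \<alpha> and \<alpha>, and the cosine decreases on [0, pi], so comparing squares
  orders the angles.\<close>

lemma tet_gamma_facts:
  assumes "1 / sqrt 2 \<le> t" "t < sqrt 3 / 2"
  shows "0 \<le> t / sqrt (3 * (1 - t\<^sup>2))" "t / sqrt (3 * (1 - t\<^sup>2)) \<le> 1"
    "0 \<le> tet_gamma t" "tet_gamma t \<le> pi / 2" "cos (tet_gamma t) = t / sqrt (3 * (1 - t\<^sup>2))"
    "tet_gamma t \<le> pi / 2 - tet_alpha" "t > 1 / sqrt 2 \<Longrightarrow> tet_gamma t < pi / 2 - tet_alpha"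
    "t < sqrt (2/3) \<Longrightarrow> tet_alpha \<le> tet_gamma t" "sqrt (2/3) \<le> t \<Longrightarrow> tet_gamma t \<le> tet_alpha"
proof -
  let ?x = "t / sqrt (3 * (1 - t\<^sup>2))"
  have "0 < 1 / sqrt 2" by simp
  then have t0: "0 < t" using assms(1) by linarith
  have sq: "t\<^sup>2 < 3/4" using power_strict_mono[OF assms(2), of 2] t0 by (simp add: power_divide)
  then have t1: "t < 1" using power2_less_imp_less[of t 1] by simp
  have sq0: "1/2 \<le> t\<^sup>2" using power_mono[OF assms(1), of 2] by (simp add: power_divide)
  note le_iff = tet_gamma_arg_le_iff[OF less_imp_le[OF t0] t1]
  show x0: "0 \<le> ?x" using t0 t1 by (simp add: power_le_one)
  show x1: "?x \<le> 1" using le_iff[of 1] sq by simp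
  show "0 \<le> tet_gamma t" "tet_gamma t \<le> pi / 2"
    unfolding tet_gamma_def using x0 x1 by (simp add: arccos_lbound, intro arccos_le_pi2)
  show cg: "cos (tet_gamma t) = ?x"
    unfolding tet_gamma_def using x0 x1 by (intro cos_arccos) auto
  have g: "0 \<le> tet_gamma t" "tet_gamma t \<le> pi"
    unfolding tet_gamma_def using x0 x1 by (auto intro: arccos_lbound arccos_ubound)
  note a = tet_alpha_bounds
  have ca: "cos (pi / 2 - tet_alpha) = 1 / sqrt 3"
    by (simp add: cos_diff sin_tet_alpha)
  have b: "0 \<le> pi / 2 - tet_alpha" "pi / 2 - tet_alpha \<le> pi" using a by auto
  have lt3: "?x < c \<longleftrightarrow> t\<^sup>2 < c\<^sup>2 * (3 * (1 - t\<^sup>2))" if "0 \<le> c" for c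
  proof -
    have p: "3 * (1 - t\<^sup>2) > 0" using sq by simp
    have "?x < c \<longleftrightarrow> t < c * sqrt (3 * (1 - t\<^sup>2))"
      using p by (simp add: pos_divide_less_eq)
    also have "\<dots> \<longleftrightarrow> t\<^sup>2 < (c * sqrt (3 * (1 - t\<^sup>2)))\<^sup>2"
      using that t0 p by (subst (1 2) not_le[symmetric], subst power_mono_iff) auto
    finally show ?thesis using p by (simp add: power_mult_distrib)
  qed
  have "1 / sqrt 3 \<le> ?x" using lt3[of "1 / sqrt 3"] sq0 by (simp add: power_divide not_less[symmetric])
  then show "tet_gamma t \<le> pi / 2 - tet_alpha"
    using cos_mono_le_eq[OF b g] cg ca by simp
  {
    assume "t > 1 / sqrt 2"
    then have "1/2 < t\<^sup>2" using power_strict_mono[of "1 / sqrt 2" t 2] by (simp add: power_divide)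
    then have "1 / sqrt 3 < ?x" using le_iff[of "1 / sqrt 3"] by (simp add: power_divide not_le[symmetric])
    then show "tet_gamma t < pi / 2 - tet_alpha"
      using cos_mono_less_eq[OF b g] cg ca by simp
  }
  {
    assume "t < sqrt (2/3)"
    then have "t\<^sup>2 < 2/3" using t0 power_strict_mono[of t "sqrt (2/3)" 2] by simp
    then have "?x \<le> sqrt 2 / sqrt 3" using le_iff[of "sqrt 2 / sqrt 3"] by (simp add: power_divide)
    then show "tet_alpha \<le> tet_gamma t"
      using cos_mono_le_eq[OF g, of tet_alpha] a cg cos_tet_alpha by simp
  }
  {
    assume "sqrt (2/3) \<le> t"
    then have "2/3 \<le> t\<^sup>2" using power_mono[of "sqrt (2/3)" t 2] by simp
    then have "\<not> ?x < sqrt 2 / sqrt 3" by (subst lt3) (auto simp: power_divide)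
    then have "sqrt 2 / sqrt 3 \<le> ?x" by linarith
    then show "tet_gamma t \<le> tet_alpha"
      using cos_mono_le_eq[of tet_alpha "tet_gamma t"] g a cg cos_tet_alpha by simp
  }
qed

lemma tet_threshold_order: "1 / sqrt 2 < sqrt (2/3 :: real)" "sqrt (2/3) < sqrt 3 / (2 :: real)" "sqrt 3 / 2 < (1 :: real)"
proof -
  show "1 / sqrt 2 < sqrt (2/3 :: real)"
    by (rule power2_less_imp_less) (simp_all add: power_divide)
  show "sqrt (2/3) < sqrt 3 / (2 :: real)"
    by (rule power2_less_imp_less) (simp_all add: power_divide)
  show "sqrt 3 / 2 < (1 :: real)"
    by (rule power2_less_imp_less) (simp_all add: power_divide)
qed

text \<open>On the first branch this is the strict bound \<gamma> < pi/2 - \<alpha>, on the second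
  \<gamma> \<le> \<alpha> < pi/4. The support rests on it.\<close>

lemma tet_density_pos:
  assumes "1 / sqrt 2 < t" "t < 1"
  shows "0 < tet_density t"
proof -
  consider "t < sqrt (2/3)" | "sqrt (2/3) \<le> t" "t < sqrt 3 / 2" | "sqrt 3 / 2 \<le> t" by linarith
  then show ?thesis
  proof cases
    case 1
    then have "t < sqrt 3 / 2" using tet_threshold_order(2) by linarith
    with assms have "tet_alpha + tet_gamma t < pi / 2"
      using tet_gamma_facts(7)[of t] by simp
    then have "12 / pi * (tet_alpha + tet_gamma t) < 12 / pi * (pi / 2)"
      by (intro mult_strict_left_mono) auto
    with 1 assms show ?thesis by (simp add: tet_density_def)
  next
    case 2
    have "tet_gamma t < pi / 4"
      using tet_gamma_facts(9)[of t] 2 assms tet_alpha_bounds by simp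
    then have "24 / pi * tet_gamma t < 24 / pi * (pi / 4)"
      by (intro mult_strict_left_mono) auto
    with 2 assms show ?thesis by (simp add: tet_density_def)
  next
    case 3
    with assms tet_threshold_order show ?thesis by (simp add: tet_density_def)
  qed
qed

text \<open>The left end point falls under the first nonzero branch; there \<gamma> is exactly pi/2
  - \<alpha>, so the branch starts at 0.\<close>

lemma tet_density_eq_0: "t \<le> 1 / sqrt 2 \<or> 1 \<le> t \<Longrightarrow> tet_density t = 0"
proof -
  have "tet_density (1 / sqrt 2) = 0"
  proof -
    have "arccos (1 / sqrt 3) = pi / 2 - tet_alpha"
    proof -
      have "1 / sqrt 3 = cos (pi / 2 - tet_alpha)" by (simp add: cos_diff sin_tet_alpha)
      then show ?thesis using tet_alpha_bounds by (simp only:) (rule arccos_cos, auto)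
    qed
    moreover have "1 / sqrt 2 / sqrt (3 * (1 - (1 / sqrt 2)\<^sup>2)) = 1 / sqrt (3 :: real)"
      by (simp add: power_divide real_sqrt_divide)
    ultimately have "tet_gamma (1 / sqrt 2) = pi / 2 - tet_alpha" unfolding tet_gamma_def by simp
    then show ?thesis using tet_threshold_order by (simp add: tet_density_def)
  qed
  moreover assume "t \<le> 1 / sqrt 2 \<or> 1 \<le> t"
  ultimately show ?thesis
    using tet_threshold_order by (cases "t = 1 / sqrt 2") (auto simp: tet_density_def)
qed

lemma tet_density_nonneg: "0 \<le> tet_density t"
  using tet_density_pos[of t] tet_density_eq_0[of t] by linarith

lemma borel_measurable_tet_density [measurable]: "tet_density \<in> borel_measurable borel"
proof -
  \<comment> \<open>Clipping the argument makes \<open>arccos\<close> continuous on the whole line,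
    and changes nothing where the density uses \<open>tet_gamma\<close>.\<close>
  define g :: "real \<Rightarrow> real" where "g x = arccos (max (-1) (min 1 x))" for x
  have "continuous_on UNIV g"
    unfolding g_def by (intro continuous_on_arccos continuous_intros) auto
  then have [measurable]: "g \<in> borel_measurable borel"
    by (rule borel_measurable_continuous_onI)
  define \<gamma> where "\<gamma> t = g (t / sqrt (3 * (1 - t\<^sup>2)))" for t
  have [measurable]: "\<gamma> \<in> borel_measurable borel" unfolding \<gamma>_def by measurable
  have "\<gamma> t = tet_gamma t" if "1 / sqrt 2 \<le> t" "t < sqrt 3 / 2" for t
    using tet_gamma_facts(1,2)[OF that] by (simp add: \<gamma>_def g_def tet_gamma_def max_def min_def)
  then have eq: "tet_density = (\<lambda>t. if t < 1 / sqrt 2 then 0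
      else if t < sqrt (2 / 3) then 6 - 12 / pi * (tet_alpha + \<gamma> t)
      else if t < sqrt 3 / 2 then 6 - 24 / pi * \<gamma> t
      else if t < 1 then 6 else 0)"
    using tet_threshold_order by (auto simp: fun_eq_iff tet_density_def)
  show ?thesis unfolding eq by measurable
qed

section \<open>The azimuths at which an edge is longest\<close>

text \<open>For a direction at height \<open>z\<close> above the equator relative to an edge of the tetrahedron, the set below
  consists of the azimuths for which that edge has the longest projection.\<close>
definition edge_cell :: "real \<Rightarrow> real set" where
  "edge_cell z = {\<phi>. sqrt (1 - z\<^sup>2) * (\<bar>cos \<phi>\<bar> + sqrt 2 * \<bar>sin \<phi>\<bar>) \<le> z}"

text \<open>Both absolute values drop in this quadrant, and by \<open>trig\<close> the sum is a
  single cosine with its peak at \<open>\<beta>\<close>. The excluded arc never passes 0, but it may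
  pass pi/2, and then the second interval is empty.\<close>

lemma edge_cell_quadrant:
  assumes "1 / sqrt 2 \<le> z" "z < sqrt 3 / 2"
  defines "\<beta> \<equiv> pi / 2 - tet_alpha"
  shows "edge_cell z \<inter> {0..pi/2} = {0..\<beta> - tet_gamma z} \<union> {\<beta> + tet_gamma z..pi/2}"
proof -
  note g = tet_gamma_facts[OF assms(1,2)]
  note a = tet_alpha_bounds
  have "0 < 1 / sqrt 2" by simp
  then have z0: "0 < z" using assms(1) by linarith
  have "z\<^sup>2 < 3/4" using power_strict_mono[OF assms(2), of 2] z0 by (simp add: power_divide)
  then have s0: "0 < sqrt (1 - z\<^sup>2)" by simp
  have trig: "cos \<phi> + sqrt 2 * sin \<phi> = sqrt 3 * cos (\<phi> - \<beta>)" for \<phi>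
    by (simp add: \<beta>_def cos_diff sin_diff sin_add cos_tet_alpha sin_tet_alpha algebra_simps)
  have "\<phi> \<in> edge_cell z \<longleftrightarrow> \<bar>\<phi> - \<beta>\<bar> \<ge> tet_gamma z" if \<phi>: "0 \<le> \<phi>" "\<phi> \<le> pi/2" for \<phi>
  proof -
    have "0 \<le> cos \<phi>" "0 \<le> sin \<phi>" using \<phi> by (auto intro!: cos_ge_zero sin_ge_zero)
    then have "\<phi> \<in> edge_cell z \<longleftrightarrow> sqrt (1 - z\<^sup>2) * (sqrt 3 * cos (\<phi> - \<beta>)) \<le> z"
      by (simp add: edge_cell_def trig)
    also have "\<dots> \<longleftrightarrow> cos (\<phi> - \<beta>) \<le> z / sqrt (3 * (1 - z\<^sup>2))"
      using s0 unfolding real_sqrt_mult by (simp add: pos_le_divide_eq mult_ac)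
    also have "\<dots> \<longleftrightarrow> cos \<bar>\<phi> - \<beta>\<bar> \<le> cos (tet_gamma z)"
      by (simp only: g(5) cos_abs_real)
    also have "\<dots> \<longleftrightarrow> tet_gamma z \<le> \<bar>\<phi> - \<beta>\<bar>"
      using \<phi> a g(3,4) by (intro cos_mono_le_eq) (auto simp: \<beta>_def)
    finally show ?thesis .
  qed
  then have "edge_cell z \<inter> {0..pi/2} = {\<phi>\<in>{0..pi/2}. \<bar>\<phi> - \<beta>\<bar> \<ge> tet_gamma z}" by auto
  also have "\<dots> = {0..\<beta> - tet_gamma z} \<union> {\<beta> + tet_gamma z..pi/2}"
    using g(3,6) a by (auto simp: \<beta>_def abs_if split: if_splits)
  finally show ?thesis .
qed

text \<open>The sum is at least 1, its value at \<phi> = 0, while here z < sqrt (1 - z^2). Negative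
  heights are included: of the two directions of an edge, one with negative inner product never
  counts.\<close>

lemma edge_cell_low:
  assumes "-1 < z" "z < 1 / sqrt 2"
  shows "edge_cell z = {}"
proof -
  have "z < sqrt (1 - z\<^sup>2)"
  proof (cases "z \<le> 0")
    case True
    then have "z\<^sup>2 < 1" using assms(1) by (simp add: abs_square_less_1)
    then have "0 < sqrt (1 - z\<^sup>2)" by simp
    with True show ?thesis by linarith
  next
    case False
    then have "z\<^sup>2 < 1/2" using power_strict_mono[OF assms(2), of 2] by (simp add: power_divide)
    then show ?thesis by (intro real_less_rsqrt) simp
  qed
  moreover have "1 \<le> \<bar>cos \<phi>\<bar> + sqrt 2 * \<bar>sin \<phi>\<bar>" for \<phi>
  proof -
    have "1\<^sup>2 \<le> (\<bar>cos \<phi>\<bar> + \<bar>sin \<phi>\<bar>)\<^sup>2"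
      using sin_cos_squared_add[of \<phi>] by (simp add: power2_sum)
    then have "1 \<le> \<bar>cos \<phi>\<bar> + \<bar>sin \<phi>\<bar>" by (rule power2_le_imp_le) simp
    moreover have "1 * \<bar>sin \<phi>\<bar> \<le> sqrt 2 * \<bar>sin \<phi>\<bar>" by (rule mult_right_mono) auto
    ultimately show ?thesis by simp
  qed
  moreover have "0 \<le> sqrt (1 - z\<^sup>2)"
  proof -
    have "z\<^sup>2 \<le> 1"
    proof -
      have "z < 1" using assms(2) tet_threshold_order by linarith
      then show ?thesis using assms(1) by (simp add: abs_square_le_1)
    qed
    then show ?thesis by simp
  qed
  ultimately have "z < sqrt (1 - z\<^sup>2) * (\<bar>cos \<phi>\<bar> + sqrt 2 * \<bar>sin \<phi>\<bar>)" for \<phi>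
    using mult_left_mono[of 1 "\<bar>cos \<phi>\<bar> + sqrt 2 * \<bar>sin \<phi>\<bar>" "sqrt (1 - z\<^sup>2)"] by simp
  then show ?thesis by (auto simp: edge_cell_def not_le)
qed

lemma edge_cell_high:
  assumes "sqrt 3 / 2 \<le> z" "z < 1"
  shows "edge_cell z = UNIV"
proof -
  have z0: "0 < z" using assms(1) by (smt (verit) divide_pos_pos real_sqrt_gt_zero)
  have "3/4 \<le> z\<^sup>2" using power_mono[OF assms(1), of 2] by (simp add: power_divide)
  have "(\<bar>cos \<phi>\<bar> + sqrt 2 * \<bar>sin \<phi>\<bar>)\<^sup>2 \<le> 3" for \<phi>
  proof -
    \<comment> \<open>This square is the defect in the Cauchy-Schwarz inequality for (1, sqrt 2) and
      (|cos \<phi>|, |sin \<phi>|).\<close>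
    have "0 \<le> (sqrt 2 * \<bar>cos \<phi>\<bar> - \<bar>sin \<phi>\<bar>)\<^sup>2" by simp
    then have "(\<bar>cos \<phi>\<bar> + sqrt 2 * \<bar>sin \<phi>\<bar>)\<^sup>2 \<le> 3 * (sin \<phi>)\<^sup>2 + 3 * (cos \<phi>)\<^sup>2"
      by (simp only: power2_sum power2_diff power_mult_distrib power2_abs) (simp add: algebra_simps)
    then show ?thesis using sin_cos_squared_add[of \<phi>] by linarith
  qed
  then have "(sqrt (1 - z\<^sup>2) * (\<bar>cos \<phi>\<bar> + sqrt 2 * \<bar>sin \<phi>\<bar>))\<^sup>2 \<le> (1 - z\<^sup>2) * 3" for \<phi>
    unfolding power_mult_distrib using z0 assms(2) by (intro mult_mono) (auto simp: power_le_one)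
  also have "(1 - z\<^sup>2) * 3 \<le> z\<^sup>2" using \<open>3/4 \<le> z\<^sup>2\<close> by simp
  finally have "sqrt (1 - z\<^sup>2) * (\<bar>cos \<phi>\<bar> + sqrt 2 * \<bar>sin \<phi>\<bar>) \<le> z" for \<phi>
    using z0 by (rule power2_le_imp_le[OF _ less_imp_le])
  then show ?thesis by (auto simp: edge_cell_def)
qed

lemma borel_edge_cell [measurable]: "edge_cell z \<in> sets borel"
  unfolding edge_cell_def by measurable

text \<open>The factor \<open>pi / 3\<close> is a normalisation: the full circle, of length 2 pi,
  corresponds to the plateau value 6.\<close>

lemma emeasure_edge_cell:
  assumes "-1 < z" "z < 1"
  shows "(\<integral>\<^sup>+\<phi>. indicator (edge_cell z) \<phi> * indicator {0..<2*pi} \<phi> \<partial>lborel) = ennreal (pi / 3 * tet_density z)"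
proof -
  have "(\<integral>\<^sup>+\<phi>. indicator (edge_cell z) \<phi> * indicator {0..<2*pi} \<phi> \<partial>lborel) =
      4 * (\<integral>\<^sup>+\<phi>. indicator (edge_cell z) \<phi> * indicator {0..pi/2} \<phi> \<partial>lborel)"
    by (rule nn_integral_quadrant) (auto simp: edge_cell_def indicator_def)
  also have "(\<integral>\<^sup>+\<phi>. indicator (edge_cell z) \<phi> * indicator {0..pi/2} \<phi> \<partial>lborel) =
      emeasure lborel (edge_cell z \<inter> {0..pi/2})"
    by (simp add: indicator_inter_arith[symmetric])
  also have "4 * \<dots> = ennreal (pi / 3 * tet_density z)"
  proof -
    have four: "4 * ennreal x = ennreal (4 * x)" if "0 \<le> x" for x
      using that by (simp add: ennreal_mult)
    consider "z < 1 / sqrt 2" | "1 / sqrt 2 \<le> z" "z < sqrt (2/3)"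
      | "sqrt (2/3) \<le> z" "z < sqrt 3 / 2" | "sqrt 3 / 2 \<le> z" by linarith
    then show ?thesis
    proof cases
      case 1
      then show ?thesis using assms by (simp add: edge_cell_low tet_density_eq_0)
    next
      case 2
      then have z: "1 / sqrt 2 \<le> z" "z < sqrt 3 / 2" using tet_threshold_order by linarith+
      note g = tet_gamma_facts[OF z]
      \<comment> \<open>As \<alpha> \<le> \<gamma>, the second interval is empty or just the point
        pi/2.\<close>
      have "AE \<phi> in lborel. \<phi> \<in> edge_cell z \<inter> {0..pi/2} \<longleftrightarrow> \<phi> \<in> {0..pi/2 - tet_alpha - tet_gamma z}"
        using AE_lborel_singleton[of "pi/2"] unfolding edge_cell_quadrant[OF z]
        by eventually_elim (use g(8) 2 in auto)
      then have "emeasure lborel (edge_cell z \<inter> {0..pi/2}) = emeasure lborel {0..pi/2 - tet_alpha - tet_gamma z}"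
        by (rule emeasure_eq_AE) auto
      also have "\<dots> = ennreal (pi/2 - tet_alpha - tet_gamma z)" using g(6) by simp
      also have "4 * \<dots> = ennreal (4 * (pi/2 - tet_alpha - tet_gamma z))"
        using g(6) by (intro four) simp
      also have "4 * (pi/2 - tet_alpha - tet_gamma z) = pi / 3 * tet_density z"
        using 2 by (simp add: tet_density_def field_simps)
      finally show ?thesis .
    next
      case 3
      then have z: "1 / sqrt 2 \<le> z" "z < sqrt 3 / 2" using tet_threshold_order by linarith+
      note g = tet_gamma_facts[OF z]
      note a = tet_alpha_bounds
      \<comment> \<open>Dropping one end point makes the two arcs disjoint from 0 \<le> \<gamma>
        alone.\<close>
      have "AE \<phi> in lborel. \<phi> \<in> edge_cell z \<inter> {0..pi/2} \<longleftrightarrow>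
          \<phi> \<in> {0..<pi/2 - tet_alpha - tet_gamma z} \<union> {pi/2 - tet_alpha + tet_gamma z..pi/2}"
        using AE_lborel_singleton[of "pi/2 - tet_alpha - tet_gamma z"] unfolding edge_cell_quadrant[OF z]
        by eventually_elim auto
      then have "emeasure lborel (edge_cell z \<inter> {0..pi/2}) =
          emeasure lborel ({0..<pi/2 - tet_alpha - tet_gamma z} \<union> {pi/2 - tet_alpha + tet_gamma z..pi/2})"
        by (rule emeasure_eq_AE) auto
      also have "\<dots> = emeasure lborel {0..<pi/2 - tet_alpha - tet_gamma z} +
          emeasure lborel {pi/2 - tet_alpha + tet_gamma z..pi/2}"
        using g(3) by (intro plus_emeasure[symmetric]) auto
      also have "\<dots> = ennreal (pi/2 - tet_alpha - tet_gamma z) + ennreal (tet_alpha - tet_gamma z)"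
        using g(6) g(9)[OF 3(1)] by simp
      also have "\<dots> = ennreal (pi/2 - 2 * tet_gamma z)"
        using g(6) g(9)[OF 3(1)] by (simp flip: ennreal_plus)
      also have "4 * \<dots> = ennreal (4 * (pi/2 - 2 * tet_gamma z))"
        using g(9)[OF 3(1)] a by (intro four) simp
      also have "4 * (pi/2 - 2 * tet_gamma z) = pi / 3 * tet_density z"
        using 3 z by (simp add: tet_density_def field_simps)
      finally show ?thesis .
    next
      case 4
      then have "tet_density z = 6" using assms tet_threshold_order by (simp add: tet_density_def)
      then show ?thesis using 4 assms by (simp add: edge_cell_high flip: ennreal_mult ennreal_numeral)
    qed
  qed
  finally show ?thesis .
qed

section \<open>The width of the tetrahedron\<close>

lemma SUP_inner_convex_hull:
  fixes V :: "'a::euclidean_space set"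
  assumes "finite V" "V \<noteq> {}"
  shows "(SUP x\<in>convex hull V. u \<bullet> x) = Max ((\<bullet>) u ` V)"
proof (rule cSup_eq_maximum)
  have "Max ((\<bullet>) u ` V) \<in> (\<bullet>) u ` V" using assms by (intro Max_in) auto
  then show "Max ((\<bullet>) u ` V) \<in> (\<bullet>) u ` (convex hull V)" using hull_subset[of V convex] by blast
  have "convex hull V \<subseteq> {x. u \<bullet> x \<le> Max ((\<bullet>) u ` V)}"
    using assms by (intro hull_minimal convex_halfspace_le) auto
  then show "y \<le> Max ((\<bullet>) u ` V)" if "y \<in> (\<bullet>) u ` (convex hull V)" for y using that by auto
qed

lemma INF_inner_convex_hull:
  fixes V :: "'a::euclidean_space set"
  assumes "finite V" "V \<noteq> {}"
  shows "(INF x\<in>convex hull V. u \<bullet> x) = Min ((\<bullet>) u ` V)"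
proof (rule cInf_eq_minimum)
  have "Min ((\<bullet>) u ` V) \<in> (\<bullet>) u ` V" using assms by (intro Min_in) auto
  then show "Min ((\<bullet>) u ` V) \<in> (\<bullet>) u ` (convex hull V)" using hull_subset[of V convex] by blast
  have "convex hull V \<subseteq> {x. u \<bullet> x \<ge> Min ((\<bullet>) u ` V)}"
    using assms by (intro hull_minimal convex_halfspace_ge) auto
  then show "Min ((\<bullet>) u ` V) \<le> y" if "y \<in> (\<bullet>) u ` (convex hull V)" for y using that by auto
qed

text \<open>The width of the tetrahedron in coordinates adapted to the circumscribed cube, whose face diagonals
  are the edges.\<close>
definition cube_width :: "real^3 \<Rightarrow> real" where
  "cube_width x = max (\<bar>x$1\<bar> + \<bar>x$2\<bar>) (max (\<bar>x$2\<bar> + \<bar>x$3\<bar>) (\<bar>x$3\<bar> + \<bar>x$1\<bar>)) / sqrt 2"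

text \<open>Scaled by sqrt 2, the cube coordinates become the signed sums \<open>p\<close>,
  \<open>q\<close>, \<open>r\<close> of vertex values in \<open>spread_of_four\<close>.\<close>

lemma cube_width_eq:
  "cube_width x = max (\<bar>sqrt 2 * x$1\<bar> + \<bar>sqrt 2 * x$2\<bar>)
    (max (\<bar>sqrt 2 * x$2\<bar> + \<bar>sqrt 2 * x$3\<bar>) (\<bar>sqrt 2 * x$3\<bar> + \<bar>sqrt 2 * x$1\<bar>)) / 2"
proof -
  have abs: "\<bar>sqrt 2 * z\<bar> = sqrt 2 * \<bar>z\<bar>" for z by (simp add: abs_mult)
  have div: "m / sqrt 2 = sqrt 2 * m / 2" for m by (simp add: field_simps)
  show ?thesis
    unfolding cube_width_def abs distrib_left[symmetric] div max_mult_distrib_left by (simp only: real_sqrt_ge_0_iff zero_le_numeral if_True)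
qed

text \<open>Since |p| + |q| is the larger of |p + q| and |p - q|, here 2|a - d| and 2|b - c|, the
  right side is the largest of the six pairwise differences.\<close>

lemma spread_of_four:
  fixes a b c d :: real
  defines "p \<equiv> a + b - c - d" and "q \<equiv> a - b + c - d" and "r \<equiv> a - b - c + d"
  shows "max a (max b (max c d)) - min a (min b (min c d)) =
    max (\<bar>p\<bar> + \<bar>q\<bar>) (max (\<bar>q\<bar> + \<bar>r\<bar>) (\<bar>r\<bar> + \<bar>p\<bar>)) / 2"
proof -
  have pq: "\<bar>p\<bar> + \<bar>q\<bar> = 2 * max \<bar>a - d\<bar> \<bar>b - c\<bar>" unfolding p_def q_def by (simp add: max_def abs_if)
  have qr: "\<bar>q\<bar> + \<bar>r\<bar> = 2 * max \<bar>a - b\<bar> \<bar>c - d\<bar>" unfolding q_def r_def by (simp add: max_def abs_if)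
  have rp: "\<bar>r\<bar> + \<bar>p\<bar> = 2 * max \<bar>a - c\<bar> \<bar>b - d\<bar>" unfolding r_def p_def by (simp add: max_def abs_if)
  define M m where "M = max a (max b (max c d))" and "m = min a (min b (min c d))"
  define D where "D = max (max \<bar>a - d\<bar> \<bar>b - c\<bar>) (max (max \<bar>a - b\<bar> \<bar>c - d\<bar>) (max \<bar>a - c\<bar> \<bar>b - d\<bar>))"
  have M: "a \<le> M" "b \<le> M" "c \<le> M" "d \<le> M" "M = a \<or> M = b \<or> M = c \<or> M = d"
    unfolding M_def by (auto simp: max_def)
  have m: "m \<le> a" "m \<le> b" "m \<le> c" "m \<le> d" "m = a \<or> m = b \<or> m = c \<or> m = d"
    unfolding m_def by (auto simp: min_def)
  have D: "\<bar>a - d\<bar> \<le> D" "\<bar>b - c\<bar> \<le> D" "\<bar>a - b\<bar> \<le> D" "\<bar>c - d\<bar> \<le> D" "\<bar>a - c\<bar> \<le> D" "\<bar>b - d\<bar> \<le> D"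
    unfolding D_def by (simp_all add: le_max_iff_disj)
  have "D \<le> M - m" using M(1-4) m(1-4) unfolding D_def by (simp add: abs_le_iff)
  moreover have "M - m \<le> D" using M(5) m(5) D[unfolded abs_le_iff] by (elim disjE) linarith+
  ultimately have eq: "M - m = D" by simp
  have dbl: "max (2 * x) (max (2 * y) (2 * z)) / 2 = max x (max y z)" for x y z :: real
    by (simp add: max_def)
  show ?thesis unfolding pq qr rp dbl using eq unfolding M_def m_def D_def .
qed

lemma regular_tetrahedron_width:
  assumes "regular_tetrahedron 1 T"
  obtains Q :: "real^3^3" where "rotation_matrix Q" "\<And>u. width T u = cube_width (Q *v u)"
proof -
  obtain V where V: "card V = 4" "\<And>x y. x \<in> V \<Longrightarrow> y \<in> V \<Longrightarrow> x \<noteq> y \<Longrightarrow> dist x y = 1"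
    and T: "T = convex hull V"
    using assms unfolding regular_tetrahedron_def by blast
  obtain a b c d where V_eq: "V = {a, b, c, d}" and ne: "a \<noteq> b" "a \<noteq> c" "a \<noteq> d" "b \<noteq> c" "b \<noteq> d" "c \<noteq> d"
  proof -
    have "card V = Suc (Suc (Suc (Suc 0)))" using V(1) by simp
    then show ?thesis using that unfolding card_Suc_eq by auto
  qed
  define x y z where "x = a - d" and "y = b - d" and "z = c - d"
  have sq: "(v - w) \<bullet> (v - w) = 1" if "v \<in> V" "w \<in> V" "v \<noteq> w" for v w
    using V(2)[OF that] by (simp only: dist_norm norm_eq_1)
  have diff: "a - b = x - y" "a - c = x - z" "b - c = y - z" by (simp_all add: x_def y_def z_def)
  have "x \<bullet> x = 1" "y \<bullet> y = 1" "z \<bullet> z = 1"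
    unfolding x_def y_def z_def by (rule sq; use ne in \<open>simp add: V_eq\<close>)+
  moreover have "(x - y) \<bullet> (x - y) = 1" "(x - z) \<bullet> (x - z) = 1" "(y - z) \<bullet> (y - z) = 1"
    unfolding diff[symmetric] by (rule sq; use ne in \<open>simp add: V_eq\<close>)+
  ultimately have ip: "x \<bullet> x = 1" "y \<bullet> y = 1" "z \<bullet> z = 1" "x \<bullet> y = 1/2" "x \<bullet> z = 1/2" "y \<bullet> z = 1/2"
      "y \<bullet> x = 1/2" "z \<bullet> x = 1/2" "z \<bullet> y = 1/2"
    by (simp_all add: inner_diff_left inner_diff_right inner_commute)
  \<comment> \<open>These are the unit vectors along the segments joining midpoints of opposite
    edges, for instance \<open>e\<close> along a + b - c - d: the axes of the circumscribed
    cube.\<close>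
  define e f g where "e = (1 / sqrt 2) *\<^sub>R (x + y - z)" and "f = (1 / sqrt 2) *\<^sub>R (x - y + z)"
    and "g = (1 / sqrt 2) *\<^sub>R (x - y - z)"
  have orth: "e \<bullet> e = 1" "f \<bullet> f = 1" "g \<bullet> g = 1" "e \<bullet> f = 0" "e \<bullet> g = 0" "f \<bullet> g = 0"
    by (simp_all add: e_def f_def g_def inner_diff_left inner_diff_right inner_add_left inner_add_right ip)
  \<comment> \<open>The labelling of the vertices may give a left-handed frame. Flipping
    \<open>g\<close> repairs it, and \<open>cube_width\<close> sees only absolute values.\<close>
  obtain s :: real where s: "\<bar>s\<bar> = 1" and rot: "rotation_matrix (vector [e, f, s *\<^sub>R g] :: real^3^3)"
  proof -
    have det: "det (vector [e, f, s *\<^sub>R g] :: real^3^3) = s * det (vector [e, f, g] :: real^3^3)" for s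
      by (simp add: det_3 algebra_simps)
    have orthm: "orthogonal_matrix (vector [e, f, s *\<^sub>R g] :: real^3^3)" if "\<bar>s\<bar> = 1" for s
    proof -
      have "s * s = 1" using that by (metis abs_mult_self_eq mult_1)
      then show ?thesis
        by (simp add: orthogonal_matrix_orthonormal_rows forall_3 row_def norm_eq_1 orthogonal_def orth inner_commute)
    qed
    have "\<bar>det (vector [e, f, g] :: real^3^3)\<bar> = 1"
      using det_orthogonal_matrix[OF orthm[of 1]] by auto
    then show ?thesis using that[of "det (vector [e, f, g] :: real^3^3)"] orthm det
      by (metis abs_mult_self_eq mult_1 rotation_matrix_def)
  qed
  define Q where "Q = (vector [e, f, s *\<^sub>R g] :: real^3^3)"
  have "width T u = cube_width (Q *v u)" for u
  proof -
    have Qu: "(Q *v u)$1 = e \<bullet> u" "(Q *v u)$2 = f \<bullet> u" "(Q *v u)$3 = s * (g \<bullet> u)"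
      by (simp_all add: Q_def matrix_vector_mul_component)
    have r2: "sqrt 2 * (e \<bullet> u) = u \<bullet> a + u \<bullet> b - u \<bullet> c - u \<bullet> d" "sqrt 2 * (f \<bullet> u) = u \<bullet> a - u \<bullet> b + u \<bullet> c - u \<bullet> d"
        "sqrt 2 * (g \<bullet> u) = u \<bullet> a - u \<bullet> b - u \<bullet> c + u \<bullet> d"
      by (simp_all add: e_def f_def g_def x_def y_def z_def inner_diff_right inner_add_right inner_commute[of _ u])
    have V': "finite V" "V \<noteq> {}" by (simp_all add: V_eq)
    have "width T u = Max ((\<bullet>) u ` V) - Min ((\<bullet>) u ` V)"
      unfolding width_def T by (simp only: SUP_inner_convex_hull[OF V'] INF_inner_convex_hull[OF V'])
    also have "\<dots> = max (u \<bullet> a) (max (u \<bullet> b) (max (u \<bullet> c) (u \<bullet> d))) - min (u \<bullet> a) (min (u \<bullet> b) (min (u \<bullet> c) (u \<bullet> d)))"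
      unfolding V_eq by (simp only: image_insert image_empty Max_insert Max_singleton Min_insert Min_singleton
          finite.intros insert_not_empty not_False_eq_True)
    also have "\<dots> = cube_width (Q *v u)"
      unfolding spread_of_four r2[symmetric] cube_width_eq Qu by (simp only: abs_mult s mult_1)
    finally show ?thesis .
  qed
  with rot show ?thesis using that unfolding Q_def by blast
qed

section \<open>Splitting the width over the directed edges\<close>

text \<open>Each of the twelve directed edges contributes equally to the law of the width; the summand below
  belongs to the edge direction \<open>(1, 1, 0)\<close>.\<close>
definition edge_part :: "real set \<Rightarrow> real^3 \<Rightarrow> ennreal" where
  "edge_part A x = indicator {x. (x$1 + x$2) / sqrt 2 \<in> A \<and> \<bar>x$3\<bar> \<le> x$1 \<and> \<bar>x$3\<bar> \<le> x$2} x"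

lemma borel_measurable_edge_part [measurable]:
  assumes [measurable]: "A \<in> sets borel"
  shows "edge_part A \<in> borel_measurable borel"
  unfolding edge_part_def by measurable

text \<open>The identity and three half-turns produce the four directions (+-1, +-1, 0). The third
  sign only fixes the determinant; \<open>edge_part\<close> does not see it.\<close>

definition face_part :: "real set \<Rightarrow> real^3 \<Rightarrow> ennreal" where
  "face_part A y = edge_part A y + edge_part A (mat3 1 0 0 0 (-1) 0 0 0 (-1) *v y) +
      edge_part A (mat3 (-1) 0 0 0 1 0 0 0 (-1) *v y) + edge_part A (mat3 (-1) 0 0 0 (-1) 0 0 0 1 *v y)"

lemma borel_measurable_face_part [measurable]:
  assumes [measurable]: "A \<in> sets borel"
  shows "face_part A \<in> borel_measurable borel"
  unfolding face_part_def by measurable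

text \<open>The coordinate of least modulus selects the cyclic permutation and the signs of the
  other two select the half-turn, so just one of the twelve cells contains \<open>x\<close>. Ties
  would be counted repeatedly.\<close>

lemma indicator_cube_width:
  fixes x :: "real^3"
  assumes "\<bar>x$1\<bar> \<noteq> \<bar>x$2\<bar>" "\<bar>x$2\<bar> \<noteq> \<bar>x$3\<bar>" "\<bar>x$3\<bar> \<noteq> \<bar>x$1\<bar>"
  shows "indicator A (cube_width x) = face_part A x + face_part A (mat3 0 1 0 0 0 1 1 0 0 *v x) +
    face_part A (mat3 0 0 1 1 0 0 0 1 0 *v x)"
proof -
  have face: "face_part A y = (if \<bar>y$3\<bar> < \<bar>y$1\<bar> \<and> \<bar>y$3\<bar> < \<bar>y$2\<bar> then indicator A ((\<bar>y$1\<bar> + \<bar>y$2\<bar>) / sqrt 2) else 0)"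
    if "\<bar>y$1\<bar> \<noteq> \<bar>y$2\<bar>" "\<bar>y$2\<bar> \<noteq> \<bar>y$3\<bar>" "\<bar>y$3\<bar> \<noteq> \<bar>y$1\<bar>" for y
  proof -
    have swap: "- y$2 - y$1 = - y$1 - y$2" by simp
    show ?thesis
      using that unfolding face_part_def edge_part_def mat3_vector_mult
      by (auto simp: swap indicator_def abs_if split: if_splits)
  qed
  consider "\<bar>x$3\<bar> < \<bar>x$1\<bar>" "\<bar>x$3\<bar> < \<bar>x$2\<bar>" | "\<bar>x$1\<bar> < \<bar>x$2\<bar>" "\<bar>x$1\<bar> < \<bar>x$3\<bar>" | "\<bar>x$2\<bar> < \<bar>x$3\<bar>" "\<bar>x$2\<bar> < \<bar>x$1\<bar>"
    using assms(1-3) by linarith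
  then show ?thesis
    using assms(1-3) by cases (simp_all add: face mat3_vector_mult cube_width_def max_def)
qed

context uniform_sphere
begin

lemma AE_rotation:
  assumes [measurable]: "Measurable.pred borel P" and ae: "AE x in N. P x" and rot: "rotation_matrix Q"
  shows "AE x in N. P (Q *v x)"
proof -
  have "AE x in distr N borel (\<lambda>x. Q *v x). P x"
    by (subst distr_rotation[OF rot]) (rule ae)
  then show ?thesis by (subst (asm) AE_distr_iff) auto
qed

lemma AE_third_nonzero: "AE x in N. x$3 \<noteq> 0"
proof -
  have "AE z in uniform_interval. z \<noteq> 0"
    unfolding uniform_interval_def using AE_lborel_singleton[of "0::real"]
    by (subst AE_density) (auto elim!: eventually_mono)
  then show ?thesis
    unfolding distr_third_coordinate[symmetric] by (subst (asm) AE_distr_iff) auto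
qed

text \<open>A plane through the origin is null because a rotation takes it to the equatorial plane.
  The first matrix has the unit normal of x1 = x2 as its third row; further rotations give the other
  planes.\<close>

lemma AE_coordinates_distinct:
  "AE x in N. \<bar>x$1\<bar> \<noteq> \<bar>x$2\<bar> \<and> \<bar>x$2\<bar> \<noteq> \<bar>x$3\<bar> \<and> \<bar>x$3\<bar> \<noteq> \<bar>x$1\<bar>"
proof -
  let ?r = "1 / sqrt 2"
  have "AE x in N. (mat3 ?r ?r 0 0 0 1 ?r (-?r) 0 *v x)$3 \<noteq> 0"
    by (rule AE_rotation[OF _ AE_third_nonzero]) (auto intro!: rotation_mat3I simp: power_divide)
  then have m: "AE x in N. x$1 \<noteq> x$2"
    by eventually_elim (simp add: mat3_vector_mult field_simps)
  have "AE x in N. (mat3 (-1) 0 0 0 1 0 0 0 (-1) *v x)$1 \<noteq> (mat3 (-1) 0 0 0 1 0 0 0 (-1) *v x)$2"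
    by (rule AE_rotation[OF _ m]) (auto intro!: rotation_mat3I)
  with m have 12: "AE x in N. \<bar>x$1\<bar> \<noteq> \<bar>x$2\<bar>"
    by eventually_elim (auto simp: mat3_vector_mult abs_if split: if_splits)
  have "AE x in N. \<bar>(mat3 0 1 0 0 0 1 1 0 0 *v x)$1\<bar> \<noteq> \<bar>(mat3 0 1 0 0 0 1 1 0 0 *v x)$2\<bar>"
    by (rule AE_rotation[OF _ 12]) (auto intro!: rotation_mat3I)
  moreover have "AE x in N. \<bar>(mat3 0 0 1 1 0 0 0 1 0 *v x)$1\<bar> \<noteq> \<bar>(mat3 0 0 1 1 0 0 0 1 0 *v x)$2\<bar>"
    by (rule AE_rotation[OF _ 12]) (auto intro!: rotation_mat3I)
  ultimately show ?thesis using 12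
    by eventually_elim (simp add: mat3_vector_mult)
qed

lemma nn_integral_edge_part:
  assumes [measurable]: "A \<in> sets borel"
  shows "12 * (\<integral>\<^sup>+x. edge_part A x \<partial>N) = (\<integral>\<^sup>+z. ennreal (tet_density z) * indicator A z \<partial>lborel)"
proof -
  let ?r = "1 / sqrt 2"
  \<comment> \<open>Takes the edge direction (1, 1, 0) / sqrt 2 to the pole; the entry -1 makes the
    determinant 1.\<close>
  let ?Q = "mat3 ?r (-?r) 0 0 0 (-1) ?r ?r 0"
  \<comment> \<open>The cell in the rotated frame: the smaller of x1 and x2 is (x1 + x2 - |x1 - x2|)
    / 2, to be compared with |x3|.\<close>
  define B where "B = {y :: real^3. \<bar>y$1\<bar> + sqrt 2 * \<bar>y$2\<bar> \<le> y$3}"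
  define h :: "real^3 \<Rightarrow> ennreal" where "h y = indicator A (y$3) * indicator B y" for y
  have [measurable]: "B \<in> sets borel" unfolding B_def by measurable
  have [measurable]: "h \<in> borel_measurable borel" unfolding h_def by measurable
  have rot: "rotation_matrix ?Q" by (auto intro!: rotation_mat3I simp: power_divide)
  have eq: "edge_part A x = h (?Q *v x)" for x
  proof -
    have "\<bar>x$1 - x$2\<bar> / sqrt 2 + sqrt 2 * \<bar>x$3\<bar> \<le> (x$1 + x$2) / sqrt 2 \<longleftrightarrow> \<bar>x$1 - x$2\<bar> + 2 * \<bar>x$3\<bar> \<le> x$1 + x$2"
    proof -
      have "sqrt 2 * \<bar>x$3\<bar> = 2 * \<bar>x$3\<bar> / sqrt 2" by (simp add: field_simps)
      then have "\<bar>x$1 - x$2\<bar> / sqrt 2 + sqrt 2 * \<bar>x$3\<bar> = (\<bar>x$1 - x$2\<bar> + 2 * \<bar>x$3\<bar>) / sqrt 2"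
        by (simp only: add_divide_distrib)
      then show ?thesis by (simp add: divide_le_cancel)
    qed
    also have "\<dots> \<longleftrightarrow> \<bar>x$3\<bar> \<le> x$1 \<and> \<bar>x$3\<bar> \<le> x$2" by linarith
    finally have "?Q *v x \<in> B \<longleftrightarrow> \<bar>x$3\<bar> \<le> x$1 \<and> \<bar>x$3\<bar> \<le> x$2"
      by (simp add: B_def mat3_vector_mult diff_divide_distrib[symmetric] add_divide_distrib[symmetric])
    then show ?thesis
      by (auto simp: h_def edge_part_def mat3_vector_mult add_divide_distrib indicator_def)
  qed
  have cell: "indicator B (cylinder z \<phi>) = (indicator (edge_cell z) \<phi> :: ennreal)" if "-1 < z" "z < 1" for z \<phi>
  proof -
    have "0 \<le> 1 - z\<^sup>2" using that by (simp add: abs_square_le_1)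
    then show ?thesis
      by (auto simp: B_def cylinder_def edge_cell_def indicator_def abs_mult algebra_simps)
  qed
  have "ennreal (2 * pi) * (\<integral>\<^sup>+x. edge_part A x \<partial>N) = ennreal (2 * pi) * (\<integral>\<^sup>+x. h x \<partial>N)"
    unfolding eq by (subst nn_integral_rotation[OF _ rot]) auto
  also have "\<dots> = (\<integral>\<^sup>+z. (\<integral>\<^sup>+\<phi>. h (cylinder z \<phi>) * indicator {0..<2*pi} \<phi> \<partial>lborel) \<partial>uniform_interval)"
    by (rule nn_integral_cylinder) simp
  also have "\<dots> = (\<integral>\<^sup>+z. ennreal (indicator {-1..1} z / 2) *
      (\<integral>\<^sup>+\<phi>. h (cylinder z \<phi>) * indicator {0..<2*pi} \<phi> \<partial>lborel) \<partial>lborel)"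
    by (rule nn_integral_uniform_interval) measurable
  \<comment> \<open>\<open>pi / 6\<close> is the density 1/2 of the height times the
    \<open>pi / 3\<close> of \<open>emeasure_edge_cell\<close>; twelve such shares make up the 2 pi
    on the left.\<close>
  also have "\<dots> = (\<integral>\<^sup>+z. ennreal (pi / 6) * (ennreal (tet_density z) * indicator A z) \<partial>lborel)"
  proof (rule nn_integral_cong_AE)
    show "AE z in lborel. ennreal (indicator {-1..1} z / 2) *
      (\<integral>\<^sup>+\<phi>. h (cylinder z \<phi>) * indicator {0..<2*pi} \<phi> \<partial>lborel) =
      ennreal (pi / 6) * (ennreal (tet_density z) * indicator A z)"
      using AE_lborel_singleton[of "-1"] AE_lborel_singleton[of 1]
    proof eventually_elim
      case (elim z)
      show ?case
      proof (cases "-1 < z \<and> z < 1")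
        case True
        have "(\<integral>\<^sup>+\<phi>. h (cylinder z \<phi>) * indicator {0..<2*pi} \<phi> \<partial>lborel) =
            (\<integral>\<^sup>+\<phi>. indicator A z * (indicator (edge_cell z) \<phi> * indicator {0..<2*pi} \<phi>) \<partial>lborel)"
          using True by (intro nn_integral_cong) (simp add: h_def cell mult.assoc, simp add: cylinder_def)
        also have "\<dots> = indicator A z * ennreal (pi / 3 * tet_density z)"
          using True by (subst nn_integral_cmult) (auto simp: emeasure_edge_cell)
        finally have "ennreal (indicator {-1..1} z / 2) *
            (\<integral>\<^sup>+\<phi>. h (cylinder z \<phi>) * indicator {0..<2*pi} \<phi> \<partial>lborel) =
            ennreal (1 / 2) * ennreal (pi / 3 * tet_density z) * indicator A z"
          using True by (simp add: mult_ac)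
        also have "ennreal (1 / 2) * ennreal (pi / 3 * tet_density z) = ennreal (pi / 6 * tet_density z)"
          by (subst ennreal_mult[symmetric]) (auto simp: tet_density_nonneg)
        also have "\<dots> = ennreal (pi / 6) * ennreal (tet_density z)"
          by (rule ennreal_mult) (auto simp: tet_density_nonneg)
        finally show ?thesis by (simp only: mult.assoc)
      next
        case False
        moreover have "0 < 1 / sqrt (2 :: real)" by simp
        ultimately have "tet_density z = 0" by (intro tet_density_eq_0) linarith
        then show ?thesis using False elim by (auto simp: indicator_def)
      qed
    qed
  qed
  also have "\<dots> = ennreal (pi / 6) * (\<integral>\<^sup>+z. ennreal (tet_density z) * indicator A z \<partial>lborel)"
    by (rule nn_integral_cmult) measurable
  finally have "ennreal (6 / pi) * (ennreal (2 * pi) * (\<integral>\<^sup>+x. edge_part A x \<partial>N)) =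
      ennreal (6 / pi) * (ennreal (pi / 6) * (\<integral>\<^sup>+z. ennreal (tet_density z) * indicator A z \<partial>lborel))"
    by simp
  moreover have "ennreal (6 / pi) * ennreal (2 * pi) = 12" "ennreal (6 / pi) * ennreal (pi / 6) = 1"
    by (subst ennreal_mult[symmetric]; simp)+
  ultimately show ?thesis by (simp only: mult.assoc[symmetric] mult_1)
qed

lemma distr_cube_width: "distr N borel cube_width = density lborel (\<lambda>t. ennreal (tet_density t))"
proof (rule measure_eqI)
  fix A assume "A \<in> sets (distr N borel cube_width)"
  then have [measurable]: "A \<in> sets borel" by simp
  have [measurable]: "cube_width \<in> borel_measurable borel" unfolding cube_width_def by measurable
  let ?I = "\<integral>\<^sup>+x. edge_part A x \<partial>N"
  have rots: "rotation_matrix (mat3 1 0 0 0 (-1) 0 0 0 (-1))" "rotation_matrix (mat3 (-1) 0 0 0 1 0 0 0 (-1))"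
      "rotation_matrix (mat3 (-1) 0 0 0 (-1) 0 0 0 1)" "rotation_matrix (mat3 0 1 0 0 0 1 1 0 0)"
      "rotation_matrix (mat3 0 0 1 1 0 0 0 1 0)"
    by (auto intro!: rotation_mat3I)
  have face: "(\<integral>\<^sup>+x. face_part A x \<partial>N) = 4 * ?I"
  proof -
    have "(\<integral>\<^sup>+x. face_part A x \<partial>N) = ?I + ?I + ?I + ?I"
      unfolding face_part_def by (simp add: nn_integral_add nn_integral_rotation rots)
    also have "(4 :: ennreal) = 1 + 1 + 1 + 1" by simp
    then have "?I + ?I + ?I + ?I = 4 * ?I" by (simp only: distrib_right mult_1)
    finally show ?thesis .
  qed
  have "emeasure (distr N borel cube_width) A = (\<integral>\<^sup>+t. indicator A t \<partial>distr N borel cube_width)"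
    by (rule nn_integral_indicator[symmetric]) simp
  also have "\<dots> = (\<integral>\<^sup>+x. indicator A (cube_width x) \<partial>N)"
    by (rule nn_integral_distr) measurable
  also have "\<dots> = (\<integral>\<^sup>+x. face_part A x + face_part A (mat3 0 1 0 0 0 1 1 0 0 *v x) +
      face_part A (mat3 0 0 1 1 0 0 0 1 0 *v x) \<partial>N)"
    by (rule nn_integral_cong_AE, rule eventually_mono[OF AE_coordinates_distinct])
      (simp add: indicator_cube_width)
  also have "\<dots> = 4 * ?I + 4 * ?I + 4 * ?I"
    by (simp add: nn_integral_add nn_integral_rotation rots face)
  also have "\<dots> = 12 * ?I"
  proof -
    have "(12 :: ennreal) = 4 + 4 + 4" by simp
    then show ?thesis by (simp only: distrib_right)
  qed
  also have "\<dots> = (\<integral>\<^sup>+z. ennreal (tet_density z) * indicator A z \<partial>lborel)"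
    by (rule nn_integral_edge_part) simp
  also have "\<dots> = emeasure (density lborel (\<lambda>t. ennreal (tet_density t))) A"
    by (rule emeasure_density[symmetric]) auto
  finally show "emeasure (distr N borel cube_width) A = emeasure (density lborel (\<lambda>t. ennreal (tet_density t))) A" .
qed simp

end

text \<open>Positivity inside suffices: an open set around any point of the closed interval meets
  the open interval in a nonempty open set, which is not Lebesgue null.\<close>

lemma measure_support_tet_density:
  "measure_support (density lborel (\<lambda>t. ennreal (tet_density t))) = {1 / sqrt 2 .. 1}" (is "measure_support ?D = _")
proof (intro subset_antisym subsetI)
  fix x assume x: "x \<in> measure_support ?D"
  show "x \<in> {1 / sqrt 2 .. 1}"
  proof (rule ccontr)
    assume "x \<notin> {1 / sqrt 2 .. 1}"
    then have "emeasure ?D (- {1 / sqrt 2 .. 1}) > 0"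
      using x unfolding measure_support_def by (auto simp: open_Compl)
    moreover have "emeasure ?D (- {1 / sqrt 2 .. 1}) =
        (\<integral>\<^sup>+t. ennreal (tet_density t) * indicator (- {1 / sqrt 2 .. 1}) t \<partial>lborel)"
      by (rule emeasure_density) auto
    moreover have "\<dots> = (\<integral>\<^sup>+t. 0 \<partial>(lborel :: real measure))"
    proof (rule nn_integral_cong)
      show "ennreal (tet_density t) * indicator (- {1 / sqrt 2 .. 1}) t = 0" for t
      proof (cases "t \<in> {1 / sqrt 2 .. 1}")
        case False
        then have "tet_density t = 0" by (intro tet_density_eq_0) auto
        then show ?thesis by simp
      qed simp
    qed
    ultimately show False by simp
  qed
next
  fix x :: real assume x: "x \<in> {1 / sqrt 2 .. 1}"
  have "emeasure ?D S > 0" if S: "open S" "x \<in> S" for S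
  proof (rule ccontr)
    assume "\<not> emeasure ?D S > 0"
    then have 0: "emeasure ?D S = 0" by simp
    have [measurable]: "S \<in> sets borel" using S by simp
    have "(\<integral>\<^sup>+t. ennreal (tet_density t) * indicator S t \<partial>lborel) = 0"
      using 0 by (subst (asm) emeasure_density) auto
    then have ae: "AE t in lborel. ennreal (tet_density t) * indicator S t = 0"
      by (subst (asm) nn_integral_0_iff_AE) auto
    have "x \<in> closure {1 / sqrt 2 <..< 1}"
      using x tet_threshold_order by (subst closure_greaterThanLessThan) auto
    then have "S \<inter> {1 / sqrt 2 <..< 1} \<noteq> {}"
      using S open_Int_closure_eq_empty[of S "{1 / sqrt 2 <..< 1}"] by blast
    moreover have "AE t in lborel. t \<notin> S \<inter> {1 / sqrt 2 <..< 1}"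
      using ae by eventually_elim (use tet_density_pos in \<open>fastforce simp: indicator_def ennreal_eq_0_iff\<close>)
    then have "S \<inter> {1 / sqrt 2 <..< 1} \<in> null_sets lborel"
      by (subst AE_iff_null_sets) (auto intro!: sets.Int)
    then have "negligible (S \<inter> {1 / sqrt 2 <..< 1})"
      unfolding negligible_iff_null_sets by (rule null_sets_completionI)
    ultimately show False
      using open_not_negligible[OF open_Int[OF S(1) open_greaterThanLessThan]] by blast
  qed
  then show "x \<in> measure_support ?D" by (auto simp: measure_support_def)
qed

theorem theorem4p3:
  fixes M :: "'w measure" and U :: "'w \<Rightarrow> real^3" and T :: "(real^3) set"
  assumes "prob_space M"
    and "U \<in> borel_measurable M"
    and "uniform_sphere_measure (distr M borel U)"
    and "regular_tetrahedron 1 T"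
  defines "W \<equiv> \<lambda>\<omega>. width T (U \<omega>)"
  shows "absolutely_continuous lborel (distr M borel W)
       \<and> measure_support (distr M borel W) = {1 / sqrt 2 .. 1}
       \<and> (\<forall>t. 0 \<le> tet_density t)
       \<and> distributed M lborel W (\<lambda>t. ennreal (tet_density t))"
proof -
  obtain Q :: "real^3^3" where Q: "rotation_matrix Q" "\<And>u. width T u = cube_width (Q *v u)"
    using regular_tetrahedron_width[OF assms(4)] by blast
  interpret uniform_sphere "distr M borel U"
    by (rule uniform_sphere.intro) fact
  note [measurable] = assms(2)
  have [measurable]: "cube_width \<in> borel_measurable borel" unfolding cube_width_def by measurable
  have W: "W = (\<lambda>\<omega>. cube_width (Q *v U \<omega>))" by (simp add: W_def Q(2))
  have [measurable]: "W \<in> borel_measurable M" unfolding W by measurable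
  \<comment> \<open>The position of \<open>T\<close> enters through \<open>Q\<close> alone, and the
    invariance of the law of \<open>U\<close> absorbs it.\<close>
  have "distr M borel W = distr (distr (distr M borel U) borel (\<lambda>x. Q *v x)) borel cube_width"
    by (simp add: distr_distr W comp_def)
  also have "\<dots> = density lborel (\<lambda>t. ennreal (tet_density t))"
    by (simp only: distr_rotation[OF Q(1)] distr_cube_width)
  finally have D: "distr M borel W = density lborel (\<lambda>t. ennreal (tet_density t))" .
  \<comment> \<open>\<open>distr\<close> depends on its target only through the sigma
    algebra.\<close>
  moreover have "distr M lborel W = distr M borel W" by (rule distr_cong) auto
  ultimately have "distributed M lborel W (\<lambda>t. ennreal (tet_density t))"
    by (simp add: distributed_def)
  moreover have "absolutely_continuous lborel (distr M borel W)"
    unfolding D by (rule absolutely_continuousI_density) simp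
  ultimately show ?thesis
    using measure_support_tet_density tet_density_nonneg by (simp add: D)
qed

end
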